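(* Let $\beta>0$ and $m\ge1$, and let $D=\sum_{v\in V(G^n_{m,\beta})}\binom{d(v)}{2}$ be the number of pairs of adjacent half-edges in $G^n_{m,\beta}$. For any $\epsilon>0$ and $\gamma>0$ there exists $n^*$ such that for all $n\ge n^*$, \[ \Pr\left(|D-\mathbb{E}[D]|\ge n^{\frac{4+\beta}{4+2\beta}+\epsilon}\right)\le n^{-\gamma}. \]
   Context: Fix a real $\beta>0$ and a positive integer $m$. The random tree process $(G^n_{1,\beta})_{n\ge1}$ is defined as follows. $G^1_{1,\beta}$ consists of a single vertex $v_1$ and no edges. Given $G^n_{1,\beta}$ with vertices $v_1,\dots,v_n$ and directed edges $e_2,\dots,e_n$ (where $e_i$ is the edge whose tail is $v_i$), $G^{n+1}_{1,\beta}$ is obtained by adding a vertex $v_{n+1}$ and a directed edge $e_{n+1}$ with tail $v_{n+1}$ and head a "target vertex" determined by a random variable $f_{n+1}$, independent of $f_2,\dots,f_n$, taking values in $\Omega_{n+1}=\{(i,v):1\le i\le n\}\cup\{(i,h),(i,t):2\le i\le n\}$ with $\Pr(f_{n+1}=(i,v))=\beta/((2+\beta)n-2)$ and $\Pr(f_{n+1}=(i,h))=\Pr(f_{n+1}=(i,t))=1/((2+\beta)n-2)$. If $f_{n+1}=(i,v)$ the target is $v_i$ (chosen "uniformly"); if $f_{n+1}=(i,h)$ the target is the head of $e_i$, and if $f_{n+1}=(i,t)$ the target is the tail $v_i$ of $e_i$ (chosen "preferentially", by copying the head half-edge, resp. tail half-edge, of $e_i$). Consequently the target is $v_i$ with probability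 $(d_n(v_i)+\beta)/((2+\beta)n-2)$, where $d_n(v)$ is the degree of $v$ in $G^n_{1,\beta}$. Each edge is regarded as two half-edges, one at each endpoint; the degree of a vertex is the number of half-edges at it (loops count twice). For $n\ge1$, $G^n_{m,\beta}$ is the undirected multigraph obtained from $G^{nm}_{1,\beta}$ by identifying, for each $j=1,\dots,n$, the vertices $v_{(j-1)m+1},\dots,v_{jm}$ into a single vertex $w_j$, keeping all edges (so loops and multiple edges may occur). Two distinct half-edges are adjacent if they have the same endpoint. *)

theory Defs
  imports "HOL-Probability.Probability"
begin

datatype choice = Vx nat | Hd nat | Tl nat

text \<open>A tree G^N_{1,beta} is encoded by its head function: h i is the index of the
head of edge e_i (whose tail is v_i), for 2 <= i <= N; h i = 0 elsewhere.\<close>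

definition choice_weight :: "real \<Rightarrow> nat \<Rightarrow> choice \<Rightarrow> real" where
  "choice_weight \<beta> n c = (case c of
      Vx i \<Rightarrow> (if 1 \<le> i \<and> i \<le> n then \<beta> / ((2 + \<beta>) * real n - 2) else 0)
    | Hd i \<Rightarrow> (if 2 \<le> i \<and> i \<le> n then 1 / ((2 + \<beta>) * real n - 2) else 0)
    | Tl i \<Rightarrow> (if 2 \<le> i \<and> i \<le> n then 1 / ((2 + \<beta>) * real n - 2) else 0))"

definition choice_pmf :: "real \<Rightarrow> nat \<Rightarrow> choice pmf" where
  "choice_pmf \<beta> n = embed_pmf (choice_weight \<beta> n)"

fun target :: "(nat \<Rightarrow> nat) \<Rightarrow> choice \<Rightarrow> nat" where
  "target h (Vx i) = i"
| "target h (Hd i) = h i"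
| "target h (Tl i) = i"

fun tree_pmf :: "real \<Rightarrow> nat \<Rightarrow> (nat \<Rightarrow> nat) pmf" where
  "tree_pmf \<beta> 0 = return_pmf (\<lambda>_. 0)"
| "tree_pmf \<beta> (Suc 0) = return_pmf (\<lambda>_. 0)"
| "tree_pmf \<beta> (Suc (Suc k)) =
     bind_pmf (tree_pmf \<beta> (Suc k))
       (\<lambda>h. map_pmf (\<lambda>f. h(Suc (Suc k) := target h f)) (choice_pmf \<beta> (Suc k)))"

text \<open>Index j of the merged vertex w_j containing v_k.\<close>
definition grp :: "nat \<Rightarrow> nat \<Rightarrow> nat" where
  "grp m k = (k - 1) div m + 1"

text \<open>Degree of w_j in G^n_{m,beta}, obtained from the head function h of G^{nm}_{1,beta}:
 number of tail half-edges plus number of head half-edges at w_j.\<close>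
definition deg_m :: "nat \<Rightarrow> nat \<Rightarrow> (nat \<Rightarrow> nat) \<Rightarrow> nat \<Rightarrow> nat" where
  "deg_m m n h j = card {i \<in> {2..n*m}. grp m i = j} + card {i \<in> {2..n*m}. grp m (h i) = j}"

definition D_pairs :: "nat \<Rightarrow> nat \<Rightarrow> (nat \<Rightarrow> nat) \<Rightarrow> real" where
  "D_pairs m n h = (\<Sum>j = 1..n. real (deg_m m n h j choose 2))"

end

theory Submission
  imports Defs
begin

text \<open>
  Write \<open>\<alpha> = 1 / (2 + \<beta>)\<close>, and let the weight of a vertex be its degree plus \<open>\<beta>\<close>, so that targets are
  chosen proportionally to weight. Up to a deterministic term, \<open>D\<close> is half of \<open>Q\<close>, the sum of the squared
  group weights. The conditional expectation of one step is affine in \<open>Q\<close> and in the weight \<open>Y\<close> of the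
  group under construction, so a suitable combination of the centred \<open>Q\<close> and \<open>Y\<close> is a martingale
  ending at \<open>Q - E Q\<close>. Its increment at time \<open>t\<close> is at most a constant times
  \<open>(N / t)\<^sup>2\<^sup>\<alpha>\<close> times the maximal weight, whose moments are of order \<open>t\<^sup>\<alpha>\<close> because rising factorials of
  weights have an exactly linear drift. Adding up the squared increments gives \<open>N\<^sup>1\<^sup>+\<^sup>2\<^sup>\<alpha>\<close>, and an
  inductive bound on the \<open>2k\<close>-th moment of the martingale together with Markov's inequality for
  large \<open>k\<close> replaces a truncated Azuma inequality.
\<close>

section \<open>Analytic and moment inequalities\<close>

declare One_nat_def [simp del]

section \<open>Bernoulli-type inequalities for real powers\<close>

text \<open>Weighted AM-GM for \<open>y\<close> and \<open>1\<close> with weights \<open>p\<close>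
  and \<open>1 - p\<close>.\<close>

lemma one_plus_mult_ge_powr:
  fixes y p :: real
  assumes "y > 0" "0 \<le> p" "p \<le> 1"
  shows "y powr p \<le> 1 + p * (y - 1)"
  using Youngs_inequality_0[of p "1 - p" y 1] assms by (simp add: algebra_simps)

text \<open>The concave case, applied to \<open>y powr p\<close> with exponent
  \<open>1 / p\<close>.\<close>

lemma one_plus_mult_le_powr:
  fixes y p :: real
  assumes "y > 0" "p \<ge> 1"
  shows "1 + p * (y - 1) \<le> y powr p"
proof -
  have "y = (y powr p) powr (1 / p)"
    using assms by (simp add: powr_powr)
  also have "\<dots> \<le> 1 + 1 / p * (y powr p - 1)"
    using assms by (intro one_plus_mult_ge_powr) auto
  finally show ?thesis
    using assms by (simp add: field_simps)
qed

text \<open>Makes multiples of \<open>u powr p\<close> supersolutions of a recursion with growth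
  factor \<open>1 + p / u\<close>, the kind that the weight moments satisfy.\<close>

lemma add_powr_ge:
  fixes u p :: real
  assumes "u > 0" "p \<ge> 1"
  shows "u powr p * (1 + p / u) \<le> (u + 1) powr p"
proof -
  have "u powr p * (1 + p / u) \<le> u powr p * ((u + 1) / u) powr p"
    using one_plus_mult_le_powr[of "(u + 1) / u" p] assms
    by (intro mult_left_mono) (auto simp: field_simps)
  also have "\<dots> = (u + 1) powr p"
    using assms by (simp add: powr_divide)
  finally show ?thesis .
qed

text \<open>The reciprocal power is at most \<open>1 - p / u\<close>, and
  \<open>(1 + x) * (1 - x) \<le> 1\<close>. The quotient on the right is chosen because such factors
  telescope.\<close>

lemma one_plus_divide_le_powr:
  fixes u p :: real
  assumes "u > 1" "0 \<le> p" "p \<le> 1"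
  shows "1 + p / u \<le> (u / (u - 1)) powr p"
proof -
  have "((u - 1) / u) powr p \<le> 1 + p * ((u - 1) / u - 1)"
    using assms by (intro one_plus_mult_ge_powr) auto
  also have "\<dots> = 1 - p / u"
    using assms by (simp add: field_simps)
  finally have *: "((u - 1) / u) powr p \<le> 1 - p / u" .
  have "(1 + p / u) * ((u - 1) / u) powr p \<le> (1 + p / u) * (1 - p / u)"
    using * assms by (intro mult_left_mono) auto
  also have "\<dots> \<le> 1"
    by (simp add: algebra_simps)
  finally show ?thesis
    using assms by (simp add: powr_divide field_simps)
qed

text \<open>Concavity: the increment is at least the slope at the right end. It turns sums of
  \<open>u powr (p - 1)\<close> into telescoping differences.\<close>

lemma powr_diff_ge:
  fixes u p :: real
  assumes "u > 0" "0 < p" "p \<le> 1"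
  shows "p * (u + 1) powr (p - 1) \<le> (u + 1) powr p - u powr p"
proof -
  have "u powr p = (u / (u + 1)) powr p * (u + 1) powr p"
    using assms by (simp add: powr_divide)
  also have "\<dots> \<le> (1 + p * (u / (u + 1) - 1)) * (u + 1) powr p"
    using assms by (intro mult_right_mono one_plus_mult_ge_powr) auto
  also have "\<dots> = (u + 1) powr p - p * (u + 1) powr (p - 1)"
    using assms by (simp add: powr_diff field_simps)
  finally show ?thesis by simp
qed

section \<open>Interpolation and growth of even moments\<close>

lemma abs_power_mult_le:
  fixes x y :: real
  assumes "a + b = c"
  shows "\<bar>x\<bar> ^ a * \<bar>y\<bar> ^ b \<le> \<bar>x\<bar> ^ c + \<bar>y\<bar> ^ c"
proof -
  have "\<bar>x\<bar> ^ a * \<bar>y\<bar> ^ b \<le> (max \<bar>x\<bar> \<bar>y\<bar>) ^ a * (max \<bar>x\<bar> \<bar>y\<bar>) ^ b"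
    by (intro mult_mono power_mono) auto
  also have "\<dots> = (max \<bar>x\<bar> \<bar>y\<bar>) ^ c"
    using assms by (simp add: power_add [symmetric])
  also have "\<dots> \<le> \<bar>x\<bar> ^ c + \<bar>y\<bar> ^ c"
    by (auto simp: max_def)
  finally show ?thesis .
qed

text \<open>The first-order term is kept exact because a martingale increment averages to zero. Each
  higher binomial term is interpolated between the exponents \<open>2\<close> and
  \<open>2 * k\<close> of \<open>y\<close>, and the row of coefficients sums to
  \<open>4 ^ k\<close>.\<close>

lemma power_add_le_even:
  fixes x y :: real
  assumes "k \<ge> 1"
  shows "(x + y) ^ (2 * k) \<le> x ^ (2 * k) + real (2 * k) * x ^ (2 * k - 1) * y
           + 4 ^ k * (x ^ (2 * k - 2) * y\<^sup>2 + y ^ (2 * k))"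
proof -
  define T where "T i = real (2 * k choose i) * y ^ i * x ^ (2 * k - i)" for i
  have eq: "(x + y) ^ (2 * k) = (\<Sum>i\<le>2 * k. T i)"
    unfolding T_def by (subst add.commute, subst binomial_ring) simp
  have le: "T i \<le> real (2 * k choose i) * (x ^ (2 * k - 2) * y\<^sup>2 + y ^ (2 * k))"
    if i: "2 \<le> i" "i \<le> 2 * k" for i
  proof -
    have "y ^ i * x ^ (2 * k - i) \<le> \<bar>y ^ i * x ^ (2 * k - i)\<bar>"
      by simp
    also have "\<dots> = \<bar>y\<bar>\<^sup>2 * (\<bar>x\<bar> ^ (2 * k - i) * \<bar>y\<bar> ^ (i - 2))"
    proof -
      have "\<bar>y\<bar> ^ i = \<bar>y\<bar>\<^sup>2 * \<bar>y\<bar> ^ (i - 2)"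
        using i le_add_diff_inverse[of 2 i] power_add[of "\<bar>y\<bar>" 2 "i - 2"] by simp
      thus ?thesis by (simp only: abs_mult power_abs mult_ac)
    qed
    also have "\<dots> \<le> \<bar>y\<bar>\<^sup>2 * (\<bar>x\<bar> ^ (2 * k - 2) + \<bar>y\<bar> ^ (2 * k - 2))"
      using i by (intro mult_left_mono abs_power_mult_le) auto
    also have "\<dots> = x ^ (2 * k - 2) * y\<^sup>2 + y ^ (2 * k)"
    proof -
      have "\<bar>x\<bar> ^ (2 * k - 2) = x ^ (2 * k - 2)" "\<bar>y\<bar> ^ (2 * k - 2) = y ^ (2 * k - 2)"
        by (simp_all add: power_even_abs)
      moreover have "y\<^sup>2 * y ^ (2 * k - 2) = y ^ (2 * k)"
        by (metis assms power_add le_add_diff_inverse mult_le_mono2 mult_numeral_1_right numeral_One)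
      ultimately show ?thesis by (simp add: algebra_simps)
    qed
    finally have "y ^ i * x ^ (2 * k - i) \<le> x ^ (2 * k - 2) * y\<^sup>2 + y ^ (2 * k)" .
    thus ?thesis
      unfolding T_def by (simp add: mult.assoc mult_left_mono)
  qed
  have nn: "0 \<le> x ^ (2 * k - 2) * y\<^sup>2 + y ^ (2 * k)"
    by (auto intro!: add_nonneg_nonneg mult_nonneg_nonneg simp: zero_le_even_power)
  have "(\<Sum>i\<le>2 * k. T i) = T 0 + T 1 + (\<Sum>i\<in>{2..2 * k}. T i)"
  proof -
    have "{..2 * k} = insert 0 (insert 1 {2..2 * k})" using assms by auto
    thus ?thesis by simp
  qed
  also have "(\<Sum>i\<in>{2..2 * k}. T i)
      \<le> (\<Sum>i\<in>{2..2 * k}. real (2 * k choose i) * (x ^ (2 * k - 2) * y\<^sup>2 + y ^ (2 * k)))"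
    by (intro sum_mono le) auto
  also have "\<dots> \<le> (\<Sum>i\<le>2 * k. real (2 * k choose i) * (x ^ (2 * k - 2) * y\<^sup>2 + y ^ (2 * k)))"
    using nn by (intro sum_mono2) auto
  also have "\<dots> = real (\<Sum>i\<le>2 * k. 2 * k choose i) * (x ^ (2 * k - 2) * y\<^sup>2 + y ^ (2 * k))"
    by (simp add: sum_distrib_right)
  also have "real (\<Sum>i\<le>2 * k. 2 * k choose i) = 4 ^ k"
    by (simp add: choose_row_sum power_mult)
  finally show ?thesis
    unfolding eq by (simp add: T_def mult_ac One_nat_def)
qed

text \<open>Each summand is dominated by its own binomial term; \<open>2 \<le> k\<close> keeps the
  last two distinct. This lets a moment bound remain a perfect \<open>k\<close>-th power from step
  to step.\<close>

lemma add_power_ge: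
  fixes v w :: real
  assumes "0 \<le> v" "0 \<le> w" "2 \<le> k"
  shows "v ^ k + v ^ (k - 1) * w + w ^ k \<le> (v + w) ^ k"
  using assms(3)
proof (induction k rule: dec_induct)
  case base
  thus ?case using assms by (simp add: power2_eq_square algebra_simps)
next
  case (step k)
  have "v ^ Suc k + v ^ (Suc k - 1) * w + w ^ Suc k \<le> (v ^ k + v ^ (k - 1) * w + w ^ k) * (v + w)"
    using assms step by (simp add: algebra_simps)
  also have "\<dots> \<le> (v + w) ^ k * (v + w)"
    using assms step by (intro mult_right_mono) auto
  finally show ?case by (simp add: mult.commute)
qed

lemma expectation_mono_finite:
  fixes F G :: "'a \<Rightarrow> real"
  assumes "finite (set_pmf p)" "\<And>x. x \<in> set_pmf p \<Longrightarrow> F x \<le> G x"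
  shows "measure_pmf.expectation p F \<le> measure_pmf.expectation p G"
  using assms by (intro integral_mono_AE) (auto simp: integrable_measure_pmf_finite AE_measure_pmf_iff)

text \<open>The moments are interpolated after normalising by \<open>V\<close> and \<open>c\<close>, which replaces
  Hoelder's inequality by the bound \<open>x\<^sup>a y\<^sup>b \<le> x\<^sup>a\<^sup>+\<^sup>b + y\<^sup>a\<^sup>+\<^sup>b\<close>.\<close>

lemma even_moment_increment:
  fixes M R :: "'a \<Rightarrow> real"
  assumes fin: "finite (set_pmf p)" and k: "2 \<le> k" and V: "0 < V" and c: "0 < c"
    and M: "measure_pmf.expectation p (\<lambda>x. M x ^ (2 * k)) \<le> V ^ k"
    and R: "measure_pmf.expectation p (\<lambda>x. R x ^ (2 * k)) \<le> c ^ (2 * k)"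
  shows "measure_pmf.expectation p
           (\<lambda>x. M x ^ (2 * k) + 4 ^ k * (M x ^ (2 * k - 2) * (R x)\<^sup>2 + R x ^ (2 * k)))
         \<le> (V + 2 * 4 ^ k * c\<^sup>2) ^ k"
proof -
  note int = integrable_measure_pmf_finite[OF fin]
  define a where "a = sqrt V"
  have a: "a > 0" "a\<^sup>2 = V" using V by (auto simp: a_def)
  have aV: "a ^ (2 * k) = V ^ k" "a ^ (2 * k - 2) = V ^ (k - 1)"
    by (simp_all add: power_mult[symmetric] right_diff_distrib' flip: a(2))
  have pt: "M x ^ (2 * k - 2) * (R x)\<^sup>2
      \<le> V ^ (k - 1) * c\<^sup>2 * (M x ^ (2 * k) / V ^ k + R x ^ (2 * k) / c ^ (2 * k))" for x
  proof -
    have "\<bar>M x / a\<bar> ^ (2 * k - 2) * \<bar>R x / c\<bar> ^ 2 \<le> \<bar>M x / a\<bar> ^ (2 * k) + \<bar>R x / c\<bar> ^ (2 * k)"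
      using k by (intro abs_power_mult_le) auto
    hence "(M x / a) ^ (2 * k - 2) * (R x / c) ^ 2 \<le> (M x / a) ^ (2 * k) + (R x / c) ^ (2 * k)"
      using power_even_abs[of "2 * k - 2" "M x / a"] power_even_abs[of "2 * k" "M x / a"]
        power_even_abs[of "2 * k" "R x / c"] power_even_abs[of 2 "R x / c"] by simp
    hence "V ^ (k - 1) * c\<^sup>2 * ((M x / a) ^ (2 * k - 2) * (R x / c) ^ 2)
        \<le> V ^ (k - 1) * c\<^sup>2 * ((M x / a) ^ (2 * k) + (R x / c) ^ (2 * k))"
      using V by (intro mult_left_mono) auto
    moreover have "V ^ (k - 1) * c\<^sup>2 * ((M x / a) ^ (2 * k - 2) * (R x / c) ^ 2) = M x ^ (2 * k - 2) * (R x)\<^sup>2"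
      using V c a by (simp add: power_divide aV)
    ultimately show ?thesis by (simp add: power_divide aV)
  qed
  have "measure_pmf.expectation p (\<lambda>x. M x ^ (2 * k - 2) * (R x)\<^sup>2)
      \<le> measure_pmf.expectation p
          (\<lambda>x. V ^ (k - 1) * c\<^sup>2 * (M x ^ (2 * k) / V ^ k + R x ^ (2 * k) / c ^ (2 * k)))"
    by (intro expectation_mono_finite fin pt)
  also have "\<dots> = V ^ (k - 1) * c\<^sup>2 * (measure_pmf.expectation p (\<lambda>x. M x ^ (2 * k)) / V ^ k
       + measure_pmf.expectation p (\<lambda>x. R x ^ (2 * k)) / c ^ (2 * k))"
    by (simp add: Bochner_Integration.integral_add int)
  also have "\<dots> \<le> V ^ (k - 1) * c\<^sup>2 * (1 + 1)"
    using M R V c by (intro mult_left_mono add_mono) (auto simp: divide_le_eq_1)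
  finally have MR: "measure_pmf.expectation p (\<lambda>x. M x ^ (2 * k - 2) * (R x)\<^sup>2) \<le> 2 * V ^ (k - 1) * c\<^sup>2"
    by simp
  have "measure_pmf.expectation p
           (\<lambda>x. M x ^ (2 * k) + 4 ^ k * (M x ^ (2 * k - 2) * (R x)\<^sup>2 + R x ^ (2 * k)))
      = measure_pmf.expectation p (\<lambda>x. M x ^ (2 * k))
        + 4 ^ k * (measure_pmf.expectation p (\<lambda>x. M x ^ (2 * k - 2) * (R x)\<^sup>2)
                   + measure_pmf.expectation p (\<lambda>x. R x ^ (2 * k)))"
    by (simp add: Bochner_Integration.integral_add int)
  also have "\<dots> \<le> V ^ k + 4 ^ k * (2 * V ^ (k - 1) * c\<^sup>2 + c ^ (2 * k))"
    by (intro add_mono mult_left_mono M MR R) auto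
  \<comment> \<open>With \<open>w = 2 * 4 ^ k * c\<^sup>2\<close> the middle term already fits
    \<open>add_power_ge\<close>; the last one needs only
    \<open>4 ^ k \<le> (2 * 4 ^ k) ^ k\<close>.\<close>
  also have "\<dots> \<le> V ^ k + V ^ (k - 1) * (2 * 4 ^ k * c\<^sup>2) + (2 * 4 ^ k * c\<^sup>2) ^ k"
  proof -
    have "4 ^ k * 1 \<le> (2 * 4 ^ k :: real) ^ 1" by simp
    also have "\<dots> \<le> (2 * 4 ^ k) ^ k"
    proof (rule power_increasing)
      show "1 \<le> k" using k by simp
      show "1 \<le> (2 * 4 ^ k :: real)" using one_le_power[of "4::real" k] by linarith
    qed
    finally have "4 ^ k * c ^ (2 * k) \<le> (2 * 4 ^ k) ^ k * c ^ (2 * k)"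
      using c by (intro mult_right_mono) auto
    thus ?thesis
      by (simp only: power_mult power_mult_distrib) (simp add: algebra_simps)
  qed
  also have "\<dots> \<le> (V + 2 * 4 ^ k * c\<^sup>2) ^ k"
    using V k by (intro add_power_ge) auto
  finally show ?thesis .
qed

section \<open>The tree process\<close>

text \<open>Degree of \<open>v\<^sub>i\<close> in the tree plus \<open>\<beta>\<close>; meaningful only for \<open>1 \<le> i \<le> t\<close>.\<close>

definition vertex_weight :: "real \<Rightarrow> nat \<Rightarrow> (nat \<Rightarrow> nat) \<Rightarrow> nat \<Rightarrow> real" where
  "vertex_weight \<beta> t h i = \<beta> + of_bool (2 \<le> i) + (\<Sum>k=2..t. of_bool (h k = i))"

text \<open>Holds on the support of the tree law. It gives a new vertex no incoming edges and places
  every head among the vertices summed over.\<close>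

definition recursive_tree :: "nat \<Rightarrow> (nat \<Rightarrow> nat) \<Rightarrow> bool" where
  "recursive_tree t h \<longleftrightarrow> (\<forall>k\<in>{2..t}. h k \<in> {1..<k})"

lemma recursive_treeD:
  assumes "recursive_tree t h" "k \<in> {2..t}"
  shows "1 \<le> h k" "h k < k"
  using assms by (auto simp: recursive_tree_def)

definition total_weight :: "real \<Rightarrow> nat \<Rightarrow> real" where
  "total_weight \<beta> t = (2 + \<beta>) * real t - 2"

text \<open>The conditional expectation of one attachment step given the tree \<open>h\<close> at
  time \<open>t\<close>, with the three kinds of choices merged into a choice by weight.\<close>

definition attach_mean :: "real \<Rightarrow> nat \<Rightarrow> ((nat \<Rightarrow> nat) \<Rightarrow> real) \<Rightarrow> (nat \<Rightarrow> nat) \<Rightarrow> real" where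
  "attach_mean \<beta> t F h =
     (\<Sum>i=1..t. vertex_weight \<beta> t h i * F (h(Suc t := i))) / total_weight \<beta> t"

locale positive_beta =
  fixes \<beta> :: real
  assumes beta_pos: "\<beta> > 0"
begin

abbreviation "w \<equiv> vertex_weight \<beta>"
abbreviation "L \<equiv> total_weight \<beta>"
abbreviation "\<T> \<equiv> tree_pmf \<beta>"
abbreviation "E t F \<equiv> measure_pmf.expectation (\<T> t) F"

lemma total_weight_ge:
  assumes "t \<ge> 1"
  shows "\<beta> \<le> L t"
proof -
  have "(2 + \<beta>) * 1 \<le> (2 + \<beta>) * real t"
    using assms beta_pos by (intro mult_left_mono) auto
  thus ?thesis by (simp add: total_weight_def)
qed

lemma total_weight_pos: "t \<ge> 1 \<Longrightarrow> 0 < L t"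
  using total_weight_ge[of t] beta_pos by linarith

lemma vertex_weight_ge: "\<beta> \<le> w t h i"
  unfolding vertex_weight_def by (simp add: sum_nonneg)

lemma vertex_weight_pos: "0 < w t h i"
  using vertex_weight_ge[of t h i] beta_pos by linarith

text \<open>Double counting of half-edges. The three sums correspond to the choices
  \<open>Vx\<close>, \<open>Tl\<close> and \<open>Hd\<close>, so copying a random half-edge becomes
  choosing a vertex by weight.\<close>

lemma sum_vertex_weight_mult:
  assumes "t \<ge> 1" "recursive_tree t h"
  shows "(\<Sum>i=1..t. w t h i * F i)
    = \<beta> * (\<Sum>i=1..t. F i) + (\<Sum>k=2..t. F k) + (\<Sum>k=2..t. F (h k))"
proof -
  have "(\<Sum>i=1..t. w t h i * F i) = \<beta> * (\<Sum>i=1..t. F i) + (\<Sum>i=1..t. of_bool (2 \<le> i) * F i)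
      + (\<Sum>i=1..t. \<Sum>k=2..t. of_bool (h k = i) * F i)"
    by (simp add: vertex_weight_def algebra_simps sum.distrib sum_distrib_left sum_distrib_right)
  also have "(\<Sum>i=1..t. of_bool (2 \<le> i) * F i) = (\<Sum>k=2..t. F k)"
    by (rule sum.mono_neutral_cong_right) auto
  also have "(\<Sum>i=1..t. \<Sum>k=2..t. of_bool (h k = i) * F i) = (\<Sum>k=2..t. F (h k))"
  proof (subst sum.swap, rule sum.cong [OF refl])
    fix k assume "k \<in> {2..t}"
    with assms have "h k \<in> {1..t}"
      unfolding recursive_tree_def by fastforce
    hence "(\<Sum>i=1..t. of_bool (h k = i) * F i) = (\<Sum>i\<in>{h k}. of_bool (h k = i) * F i)"
      by (intro sum.mono_neutral_right) auto
    thus "(\<Sum>i=1..t. of_bool (h k = i) * F i) = F (h k)" by simp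
  qed
  finally show ?thesis .
qed

lemma sum_vertex_weight:
  assumes "t \<ge> 1" "recursive_tree t h"
  shows "(\<Sum>i=1..t. w t h i) = L t"
proof -
  have "real (card {2..t}) = real t - 1" using assms(1) by simp
  thus ?thesis
    using sum_vertex_weight_mult[OF assms, of "\<lambda>_. 1"]
    by (simp add: total_weight_def algebra_simps)
qed

lemma vertex_weight_attach:
  assumes "t \<ge> 1" "i \<le> t"
  shows "w (Suc t) (h(Suc t := a)) i = w t h i + of_bool (a = i)"
proof -
  have "{2..Suc t} = insert (Suc t) {2..t}" using assms by auto
  moreover have "(\<Sum>k=2..t. of_bool ((h(Suc t := a)) k = i)) = (\<Sum>k=2..t. of_bool (h k = i) :: real)"
    by (rule sum.cong) auto
  ultimately show ?thesis by (simp add: vertex_weight_def del: sum_of_bool_eq)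
qed

lemma vertex_weight_new:
  assumes "t \<ge> 1" "recursive_tree t h" "a \<le> t"
  shows "w (Suc t) (h(Suc t := a)) (Suc t) = 1 + \<beta>"
proof -
  have "(\<Sum>k=2..Suc t. of_bool ((h(Suc t := a)) k = Suc t) :: real) = 0"
  proof (intro sum.neutral ballI)
    fix k assume "k \<in> {2..Suc t}"
    hence "k \<noteq> Suc t \<Longrightarrow> h k < k \<and> k \<le> t"
      using assms(2) by (auto simp: recursive_tree_def)
    hence "(h(Suc t := a)) k \<le> t"
      using assms(3) by auto
    thus "of_bool ((h(Suc t := a)) k = Suc t) = (0 :: real)" by simp
  qed
  thus ?thesis using assms by (simp add: vertex_weight_def del: sum_of_bool_eq)
qed

section \<open>The law of one choice\<close>

lemma choice_support:
  "{c. choice_weight \<beta> n c \<noteq> 0} \<subseteq> Vx ` {1..n} \<union> Hd ` {2..n} \<union> Tl ` {2..n}"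
proof
  fix c assume "c \<in> {c. choice_weight \<beta> n c \<noteq> 0}"
  thus "c \<in> Vx ` {1..n} \<union> Hd ` {2..n} \<union> Tl ` {2..n}"
    by (cases c) (auto simp: choice_weight_def split: if_splits)
qed

lemma choice_weight_nonneg:
  assumes "n \<ge> 1"
  shows "0 \<le> choice_weight \<beta> n c"
  using total_weight_pos[OF assms] beta_pos
  by (auto simp: choice_weight_def total_weight_def split: choice.splits)

lemma sum_choice_weight:
  assumes "n \<ge> 1"
  shows "(\<Sum>c\<in>Vx ` {1..n} \<union> Hd ` {2..n} \<union> Tl ` {2..n}. choice_weight \<beta> n c * F c)
    = (\<beta> * (\<Sum>i=1..n. F (Vx i)) + (\<Sum>i=2..n. F (Tl i)) + (\<Sum>i=2..n. F (Hd i))) / L n"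
proof -
  have "(\<Sum>c\<in>Vx ` {1..n} \<union> Hd ` {2..n} \<union> Tl ` {2..n}. choice_weight \<beta> n c * F c)
      = (\<Sum>i=1..n. choice_weight \<beta> n (Vx i) * F (Vx i))
        + (\<Sum>i=2..n. choice_weight \<beta> n (Hd i) * F (Hd i))
        + (\<Sum>i=2..n. choice_weight \<beta> n (Tl i) * F (Tl i))"
    by (subst sum.union_disjoint, (auto)[3])+ (simp add: sum.reindex inj_on_def)
  also have "\<dots> = (\<Sum>i=1..n. \<beta> / L n * F (Vx i)) + (\<Sum>i=2..n. 1 / L n * F (Hd i))
        + (\<Sum>i=2..n. 1 / L n * F (Tl i))"
    by (intro arg_cong2[where f = "(+)"] sum.cong refl)
       (auto simp: choice_weight_def total_weight_def)
  also have "\<dots> = (\<beta> * (\<Sum>i=1..n. F (Vx i)) + (\<Sum>i=2..n. F (Tl i)) + (\<Sum>i=2..n. F (Hd i))) / L n"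
    by (simp only: sum_distrib_left [symmetric]) (simp add: add_divide_distrib)
  finally show ?thesis .
qed

lemma sum_choice_weight_1:
  assumes "n \<ge> 1"
  shows "(\<Sum>c\<in>Vx ` {1..n} \<union> Hd ` {2..n} \<union> Tl ` {2..n}. choice_weight \<beta> n c) = 1"
proof -
  have "real (card {2..n}) = real n - 1" using assms by simp
  hence "\<beta> * real (card {1..n}) + real (card {2..n}) + real (card {2..n}) = L n"
    by (simp add: total_weight_def algebra_simps)
  thus ?thesis
    using sum_choice_weight[OF assms, of "\<lambda>_. 1"] total_weight_pos[OF assms] by simp
qed

lemma nn_integral_choice_weight:
  assumes "n \<ge> 1"
  shows "(\<integral>\<^sup>+ c. ennreal (choice_weight \<beta> n c) \<partial>count_space UNIV) = 1"
proof -
  let ?A = "Vx ` {1..n} \<union> Hd ` {2..n} \<union> Tl ` {2..n}"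
  have "(\<integral>\<^sup>+ c. ennreal (choice_weight \<beta> n c) \<partial>count_space UNIV)
      = (\<Sum>c\<in>?A. ennreal (choice_weight \<beta> n c))"
  proof (rule nn_integral_count_space')
    fix c assume "c \<notin> ?A"
    hence "choice_weight \<beta> n c = 0" using choice_support[of n] by blast
    thus "ennreal (choice_weight \<beta> n c) = 0" by simp
  qed simp_all
  also have "\<dots> = ennreal (\<Sum>c\<in>?A. choice_weight \<beta> n c)"
    by (rule sum_ennreal) (rule choice_weight_nonneg[OF assms])
  also have "\<dots> = 1"
    unfolding sum_choice_weight_1[OF assms] by simp
  finally show ?thesis .
qed

lemma pmf_choice_pmf:
  assumes "n \<ge> 1"
  shows "pmf (choice_pmf \<beta> n) c = choice_weight \<beta> n c"
  unfolding choice_pmf_def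
  using choice_weight_nonneg[OF assms] nn_integral_choice_weight[OF assms]
  by (rule pmf_embed_pmf)

lemma set_choice_pmf:
  assumes "n \<ge> 1"
  shows "set_pmf (choice_pmf \<beta> n) \<subseteq> Vx ` {1..n} \<union> Hd ` {2..n} \<union> Tl ` {2..n}"
  using choice_support[of n] by (auto simp: set_pmf_eq pmf_choice_pmf[OF assms])

lemma finite_set_choice_pmf: "n \<ge> 1 \<Longrightarrow> finite (set_pmf (choice_pmf \<beta> n))"
  using set_choice_pmf by (rule finite_subset) auto

lemma expectation_choice_pmf:
  assumes "n \<ge> 1" "recursive_tree n h"
  shows "measure_pmf.expectation (choice_pmf \<beta> n) (\<lambda>c. F (target h c))
    = (\<Sum>i=1..n. w n h i * F i) / L n"
proof -
  have "measure_pmf.expectation (choice_pmf \<beta> n) (\<lambda>c. F (target h c))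
      = (\<Sum>c\<in>Vx ` {1..n} \<union> Hd ` {2..n} \<union> Tl ` {2..n}. choice_weight \<beta> n c * F (target h c))"
    using set_choice_pmf[OF assms(1)]
    by (subst integral_measure_pmf[of "Vx ` {1..n} \<union> Hd ` {2..n} \<union> Tl ` {2..n}"])
       (auto simp: pmf_choice_pmf[OF assms(1)])
  also have "\<dots> = (\<Sum>i=1..n. w n h i * F i) / L n"
    unfolding sum_choice_weight[OF assms(1)] sum_vertex_weight_mult[OF assms] by simp
  finally show ?thesis .
qed

section \<open>The law of the tree and averages over one step\<close>

lemma tree_pmf_Suc:
  assumes "t \<ge> 1"
  shows "\<T> (Suc t) = \<T> t \<bind> (\<lambda>h. map_pmf (\<lambda>c. h(Suc t := target h c)) (choice_pmf \<beta> t))"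
  using assms by (cases t) auto

lemma finite_set_tree_pmf: "finite (set_pmf (\<T> t))"
proof (induction t)
  case (Suc t)
  thus ?case
    by (cases "t = 0") (auto simp: tree_pmf_Suc finite_set_choice_pmf)
qed auto

lemma recursive_tree_support:
  assumes "h \<in> set_pmf (\<T> t)"
  shows "recursive_tree t h"
  using assms
proof (induction t arbitrary: h)
  case (Suc t)
  show ?case
  proof (cases "t = 0")
    case False
    with Suc.prems obtain h' c where h': "h' \<in> set_pmf (\<T> t)" and c: "c \<in> set_pmf (choice_pmf \<beta> t)"
      and h: "h = h'(Suc t := target h' c)"
      by (auto simp: tree_pmf_Suc)
    have r: "recursive_tree t h'" using Suc.IH[OF h'] .
    have "c \<in> Vx ` {1..t} \<union> Hd ` {2..t} \<union> Tl ` {2..t}"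
      using c set_choice_pmf[of t] False by auto
    moreover have "h' k \<in> {1..t}" if "k \<in> {2..t}" for k
      using recursive_treeD[OF r that] that by auto
    ultimately have tgt: "target h' c \<in> {1..t}"
      by auto
    show ?thesis
      unfolding recursive_tree_def
    proof
      fix k assume "k \<in> {2..Suc t}"
      thus "h k \<in> {1..<k}"
        using tgt r by (cases "k = Suc t") (auto simp: h recursive_tree_def)
    qed
  qed (auto simp: recursive_tree_def)
qed (auto simp: recursive_tree_def)

lemmas integrable_tree = integrable_measure_pmf_finite[OF finite_set_tree_pmf]

lemma expectation_mono:
  fixes F G :: "(nat \<Rightarrow> nat) \<Rightarrow> real"
  assumes "\<And>h. recursive_tree t h \<Longrightarrow> F h \<le> G h"
  shows "E t F \<le> E t G"
  by (rule expectation_mono_finite [OF finite_set_tree_pmf]) (rule assms, rule recursive_tree_support)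

lemma expectation_cong:
  fixes F G :: "(nat \<Rightarrow> nat) \<Rightarrow> real"
  assumes "\<And>h. recursive_tree t h \<Longrightarrow> F h = G h"
  shows "E t F = E t G"
  using assms by (intro antisym expectation_mono) simp_all

text \<open>Tower property: condition on the tree at time \<open>t\<close>, then average over the
  target.\<close>

lemma expectation_Suc:
  assumes "t \<ge> 1"
  shows "E (Suc t) F = E t (attach_mean \<beta> t F)"
proof -
  have "E (Suc t) F = (\<Sum>h\<in>set_pmf (\<T> t). pmf (\<T> t) h *\<^sub>R
      measure_pmf.expectation (map_pmf (\<lambda>c. h(Suc t := target h c)) (choice_pmf \<beta> t)) F)"
    unfolding tree_pmf_Suc[OF assms]
    by (rule pmf_expectation_bind) (simp_all add: finite_set_tree_pmf finite_set_choice_pmf[OF assms])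
  also have "\<dots> = (\<Sum>h\<in>set_pmf (\<T> t). pmf (\<T> t) h *\<^sub>R attach_mean \<beta> t F h)"
  proof (intro sum.cong refl)
    fix h assume "h \<in> set_pmf (\<T> t)"
    from expectation_choice_pmf[OF assms recursive_tree_support[OF this], of "\<lambda>i. F (h(Suc t := i))"]
    show "pmf (\<T> t) h *\<^sub>R measure_pmf.expectation (map_pmf (\<lambda>c. h(Suc t := target h c)) (choice_pmf \<beta> t)) F
        = pmf (\<T> t) h *\<^sub>R attach_mean \<beta> t F h"
      by (simp add: attach_mean_def)
  qed
  also have "\<dots> = E t (attach_mean \<beta> t F)"
    by (subst integral_measure_pmf[of "set_pmf (\<T> t)"]) (auto simp: finite_set_tree_pmf)
  finally show ?thesis .
qed

lemma expectation_1: "E 1 F = F (\<lambda>_. 0)" for F :: "(nat \<Rightarrow> nat) \<Rightarrow> real"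
  by (simp add: One_nat_def)

lemma attach_mean_add: "attach_mean \<beta> t (\<lambda>h. F h + G h) h = attach_mean \<beta> t F h + attach_mean \<beta> t G h"
  by (simp add: attach_mean_def ring_distribs sum.distrib add_divide_distrib)

lemma attach_mean_cmult: "attach_mean \<beta> t (\<lambda>h. c * F h) h = c * attach_mean \<beta> t F h"
  by (simp add: attach_mean_def sum_distrib_left mult_ac)

lemma attach_mean_diff: "attach_mean \<beta> t (\<lambda>h. F h - G h) h = attach_mean \<beta> t F h - attach_mean \<beta> t G h"
  using attach_mean_add[of t F "\<lambda>h. - 1 * G h" h] attach_mean_cmult[of t "-1" G h] by simp

lemma attach_mean_const:
  assumes "t \<ge> 1" "recursive_tree t h"
  shows "attach_mean \<beta> t (\<lambda>_. c) h = c"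
  using total_weight_pos[OF assms(1)]
  by (simp add: attach_mean_def sum_vertex_weight[OF assms] flip: sum_distrib_right)

lemma attach_mean_cong:
  assumes "\<And>i. i \<in> {1..t} \<Longrightarrow> F (h(Suc t := i)) = G (h(Suc t := i))"
  shows "attach_mean \<beta> t F h = attach_mean \<beta> t G h"
  unfolding attach_mean_def
  by (intro arg_cong2[where f = "(/)"] sum.cong refl) (use assms in auto)

lemma attach_mean_mono:
  assumes "t \<ge> 1" "\<And>i. i \<in> {1..t} \<Longrightarrow> F (h(Suc t := i)) \<le> G (h(Suc t := i))"
  shows "attach_mean \<beta> t F h \<le> attach_mean \<beta> t G h"
  unfolding attach_mean_def using total_weight_pos[OF assms(1)]
  by (intro divide_right_mono sum_mono mult_left_mono assms(2)) (auto simp: less_imp_le vertex_weight_pos)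

section \<open>Rising-factorial moments of the vertex weights\<close>

definition \<alpha> :: real where "\<alpha> = 1 / (2 + \<beta>)"

text \<open>The shift gives \<open>L t = u t / \<alpha>\<close>, so a drift factor
  \<open>1 + q / L t\<close> equals \<open>1 + q * \<alpha> / u t\<close> without an error
  term.\<close>

definition u :: "nat \<Rightarrow> real" where "u t = real t - 2 * \<alpha>"

lemma alpha_bounds: "0 < \<alpha>" "2 * \<alpha> < 1"
  using beta_pos by (auto simp: \<alpha>_def field_simps)

lemma total_weight_eq: "L t = u t / \<alpha>"
  using beta_pos by (simp add: total_weight_def u_def \<alpha>_def field_simps)

lemma u_Suc: "u (Suc t) = u t + 1"
  by (simp add: u_def)

lemma u_ge: "t \<ge> 1 \<Longrightarrow> 1 - 2 * \<alpha> \<le> u t"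
  by (simp add: u_def)

lemma u_pos: "t \<ge> 1 \<Longrightarrow> 0 < u t"
  using u_ge[of t] alpha_bounds by linarith

definition weight_moment :: "nat \<Rightarrow> nat \<Rightarrow> (nat \<Rightarrow> nat) \<Rightarrow> real" where
  "weight_moment q t h = (\<Sum>i=1..t. pochhammer (w t h i) q)"

text \<open>Rising factorials rather than powers: their drift under preferential attachment is exactly
  \<open>q/L\<close> times themselves.\<close>

lemma attach_mean_weight_moment:
  assumes "t \<ge> 1" "recursive_tree t h"
  shows "attach_mean \<beta> t (weight_moment q (Suc t)) h
    = (1 + real q / L t) * weight_moment q t h + pochhammer (1 + \<beta>) q"
proof -
  define P where "P x = pochhammer x q" for x :: real
  \<comment> \<open>Both \<open>x * P (x + 1)\<close> and \<open>(x + real q) * P x\<close> are the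
    rising factorial of length \<open>q + 1\<close>.\<close>
  have P: "x * (P (x + 1) - P x) = real q * P x" for x
    using pochhammer_rec[of x q] pochhammer_rec'[of x q] by (simp add: P_def algebra_simps)
  have step: "weight_moment q (Suc t) (h(Suc t := a))
      = weight_moment q t h + (P (w t h a + 1) - P (w t h a)) + P (1 + \<beta>)" if a: "a \<in> {1..t}" for a
  proof -
    have "weight_moment q (Suc t) (h(Suc t := a))
        = (\<Sum>i=1..t. P (w (Suc t) (h(Suc t := a)) i)) + P (w (Suc t) (h(Suc t := a)) (Suc t))"
      by (simp add: weight_moment_def P_def)
    also have "(\<Sum>i=1..t. P (w (Suc t) (h(Suc t := a)) i))
        = (\<Sum>i=1..t. P (w t h i) + (if i = a then P (w t h a + 1) - P (w t h a) else 0))"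
      using assms by (intro sum.cong) (auto simp: vertex_weight_attach)
    also have "\<dots> = weight_moment q t h + (P (w t h a + 1) - P (w t h a))"
      using a by (simp add: sum.distrib weight_moment_def P_def)
    finally show ?thesis
      using a assms by (simp add: vertex_weight_new del: fun_upd_apply)
  qed
  have "attach_mean \<beta> t (weight_moment q (Suc t)) h
      = (\<Sum>i=1..t. w t h i * (weight_moment q t h + P (1 + \<beta>)) + w t h i * (P (w t h i + 1) - P (w t h i))) / L t"
    unfolding attach_mean_def by (intro arg_cong2[where f = "(/)"] sum.cong refl)
      (simp add: step algebra_simps)
  also have "\<dots> = ((\<Sum>i=1..t. w t h i) * (weight_moment q t h + P (1 + \<beta>)) + real q * weight_moment q t h) / L t"
    by (simp add: sum.distrib P sum_distrib_right sum_distrib_left weight_moment_def flip: P_def)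
  finally show ?thesis
    using total_weight_pos[OF assms(1)] by (simp add: sum_vertex_weight[OF assms] P_def field_simps)
qed

text \<open>The mean satisfies a linear recursion with factor \<open>1 + p / u t\<close>, where
  \<open>p = q * \<alpha>\<close>, and a constant source from the new vertex. For
  \<open>p > 1\<close> the homogeneous growth \<open>u t powr p\<close> dominates and the source
  costs only a linear term.\<close>

lemma expectation_weight_moment_bound:
  assumes "real q * \<alpha> > 1"
  obtains C where "C > 0" "\<And>t. t \<ge> 1 \<Longrightarrow> E t (weight_moment q t) \<le> C * u t powr (real q * \<alpha>)"
proof -
  define p where "p = real q * \<alpha>"
  have p: "p > 1" using assms by (simp add: p_def)
  define f where "f = pochhammer (1 + \<beta>) q"
  have f: "f \<ge> 0" using beta_pos by (simp add: f_def pochhammer_nonneg)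
  \<comment> \<open>Since \<open>D * (p - 1) = f\<close>, the function \<open>- D * u t\<close>
    solves the recursion with source \<open>f\<close> exactly.\<close>
  define D where "D = f / (p - 1)"
  have D: "D \<ge> 0" "D * (p - 1) = f" using f p by (auto simp: D_def)
  define u1 where "u1 = u 1"
  have u1: "u1 > 0" using u_pos[of 1] by (simp add: u1_def)
  \<comment> \<open>Fitted to the value at time \<open>1\<close>; the added \<open>1\<close> keeps
    \<open>C\<close> positive.\<close>
  define C where "C = (\<bar>pochhammer \<beta> q\<bar> + D * u1) / u1 powr p + 1"
  have C: "C > 0" using D u1 by (auto simp: C_def intro!: add_nonneg_pos divide_nonneg_nonneg)
  have "E t (weight_moment q t) \<le> C * u t powr p - D * u t" if "t \<ge> 1" for t
    using that
  proof (induction t rule: dec_induct)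
    case base
    have "E 1 (weight_moment q 1) = pochhammer \<beta> q"
      by (simp add: expectation_1 weight_moment_def vertex_weight_def)
    also have "\<dots> \<le> C * u1 powr p - D * u1"
    proof -
      have "C * u1 powr p = \<bar>pochhammer \<beta> q\<bar> + D * u1 + u1 powr p"
        using u1 by (simp add: C_def field_simps)
      thus ?thesis using abs_ge_self[of "pochhammer \<beta> q"] powr_ge_zero[of u1 p] by linarith
    qed
    finally show ?case by (simp add: u1_def)
  next
    case (step t)
    have u: "u t > 0" using u_pos step by simp
    have "E (Suc t) (weight_moment q (Suc t)) = E t (\<lambda>h. (1 + real q / L t) * weight_moment q t h + f)"
      using step(1) by (subst expectation_Suc) (auto intro!: expectation_cong simp: attach_mean_weight_moment f_def)
    also have "\<dots> = (1 + real q / L t) * E t (weight_moment q t) + f"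
      by (simp add: integrable_tree Bochner_Integration.integral_add)
    also have "real q / L t = p / u t"
      using alpha_bounds by (simp add: total_weight_eq p_def)
    also have "(1 + p / u t) * E t (weight_moment q t) + f \<le> (1 + p / u t) * (C * u t powr p - D * u t) + f"
      using step u p by (intro add_right_mono mult_left_mono) auto
    also have "\<dots> = C * (u t powr p * (1 + p / u t)) - D * u t - D * p + f"
      using u by (simp add: field_simps)
    also have "\<dots> \<le> C * (u t + 1) powr p - D * u t - D * p + f"
      using add_powr_ge[of "u t" p] u p C by (intro add_right_mono diff_right_mono mult_left_mono) auto
    also have "\<dots> = C * u (Suc t) powr p - D * u (Suc t)"
      using D(2) by (simp add: u_Suc algebra_simps)
    finally show ?case .
  qed
  moreover have "C * u t powr p - D * u t \<le> C * u t powr p" if "t \<ge> 1" for t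
    using D u_pos[OF that] by simp
  ultimately show ?thesis
    using C that[of C] by (fastforce simp: p_def)
qed

end

section \<open>The martingale\<close>

lemma grp_mono: "i \<le> i' \<Longrightarrow> grp m i \<le> grp m i'"
  by (simp add: grp_def div_le_mono)

lemma grp_bounds:
  assumes "i \<in> {1..n * m}"
  shows "grp m i \<in> {1..n}"
proof -
  have "i - 1 < n * m" using assms by auto
  hence "(i - 1) div m < n" by (simp add: less_mult_imp_div_less)
  thus ?thesis by (simp add: grp_def)
qed

lemma grp_eq_iff:
  assumes "m \<ge> 1" "i \<ge> 1" "j \<ge> 1"
  shows "grp m i = j \<longleftrightarrow> i \<in> {(j - 1) * m + 1..(j - 1) * m + m}"
proof -
  have "grp m i = j \<longleftrightarrow> (i - 1) div m = j - 1"
    using assms by (auto simp: grp_def)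
  also have "\<dots> \<longleftrightarrow> (j - 1) * m \<le> i - 1 \<and> i - 1 < (j - 1) * m + m"
    using assms(1) less_eq_div_iff_mult_less_eq[of m "j - 1" "i - 1"]
      div_less_iff_less_mult[of m "i - 1" "Suc (j - 1)"]
    by (auto simp: algebra_simps)
  also have "\<dots> \<longleftrightarrow> i \<in> {(j - 1) * m + 1..(j - 1) * m + m}"
    using assms by auto
  finally show ?thesis .
qed

lemma group_members:
  assumes "m \<ge> 1" "1 \<le> j" "j \<le> n"
  shows "{i \<in> {1..n * m}. grp m i = j} = {(j - 1) * m + 1..(j - 1) * m + m}"
proof -
  have "(j - 1) * m + m = j * m" using assms by (cases j) auto
  also have "\<dots> \<le> n * m" using assms by simp
  finally have sub: "{(j - 1) * m + 1..(j - 1) * m + m} \<subseteq> {1..n * m}" by auto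
  show ?thesis
  proof (intro subset_antisym subsetI)
    fix i assume "i \<in> {i \<in> {1..n * m}. grp m i = j}"
    hence "i \<ge> 1" "grp m i = j" by auto
    thus "i \<in> {(j - 1) * m + 1..(j - 1) * m + m}"
      using grp_eq_iff[OF assms(1) _ assms(2)] by blast
  next
    fix i assume i: "i \<in> {(j - 1) * m + 1..(j - 1) * m + m}"
    with sub have i': "i \<in> {1..n * m}" by blast
    hence "i \<ge> 1" by simp
    hence "grp m i = j" using grp_eq_iff[OF assms(1) _ assms(2)] i by blast
    with i' show "i \<in> {i \<in> {1..n * m}. grp m i = j}" by blast
  qed
qed

text \<open>Only an inequality, since the block being filled at time \<open>t\<close> may be
  incomplete.\<close>

lemma card_group_le:
  assumes "m \<ge> 1"
  shows "card {i \<in> {1..t}. grp m i = j} \<le> m"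
proof (cases "j \<ge> 1")
  case True
  have "{i \<in> {1..t}. grp m i = j} \<subseteq> {(j - 1) * m + 1..(j - 1) * m + m}"
  proof
    fix i assume "i \<in> {i \<in> {1..t}. grp m i = j}"
    hence "i \<ge> 1" "grp m i = j" by auto
    thus "i \<in> {(j - 1) * m + 1..(j - 1) * m + m}"
      using grp_eq_iff[OF assms _ True] by blast
  qed
  from card_mono[OF _ this] show ?thesis by simp
next
  case False
  hence "{i \<in> {1..t}. grp m i = j} = {}" by (auto simp: grp_def)
  thus ?thesis by (simp only: card.empty)
qed

lemma real_choose_two: "real (d choose 2) = ((real d)\<^sup>2 - real d) / 2"
  by (induction d) (simp_all add: numeral_2_eq_2 field_simps)

lemma power_le_pochhammer:
  fixes x :: real
  assumes "x \<ge> 0"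
  shows "x ^ n \<le> pochhammer x n"
proof (induction n)
  case (Suc n)
  have "x ^ n * x \<le> pochhammer x n * (x + real n)"
    using assms Suc by (intro mult_mono) (auto intro: order_trans[OF zero_le_power])
  thus ?case by (simp add: pochhammer_Suc mult.commute)
qed simp

section \<open>Group weights and their one-step drift\<close>

locale merged_tree = positive_beta +
  fixes m n :: nat
  assumes m_pos: "m \<ge> 1"
begin

definition group_weight :: "nat \<Rightarrow> (nat \<Rightarrow> nat) \<Rightarrow> nat \<Rightarrow> real" where
  "group_weight t h j = (\<Sum>i=1..t. w t h i * of_bool (grp m i = j))"

definition Q :: "nat \<Rightarrow> (nat \<Rightarrow> nat) \<Rightarrow> real" where
  "Q t h = (\<Sum>j=1..n. (group_weight t h j)\<^sup>2)"

text \<open>The group is that of the next vertex, so the value is \<open>0\<close> whenever the next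
  vertex opens a new group.\<close>

definition Y :: "nat \<Rightarrow> (nat \<Rightarrow> nat) \<Rightarrow> real" where
  "Y t h = group_weight t h (grp m (Suc t))"

text \<open>The factor that resets \<open>Y\<close> to \<open>0\<close> once a group has been
  completed.\<close>

definition same_group :: "nat \<Rightarrow> real" where
  "same_group t = of_bool (grp m (Suc (Suc t)) = grp m (Suc t))"

lemma group_weight_nonneg: "0 \<le> group_weight t h j"
  unfolding group_weight_def by (intro sum_nonneg mult_nonneg_nonneg less_imp_le[OF vertex_weight_pos]) simp

lemma group_weight_le:
  assumes "\<And>i. i \<in> {1..t} \<Longrightarrow> w t h i \<le> \<mu>" "0 \<le> \<mu>"
  shows "group_weight t h j \<le> real m * \<mu>"
proof -
  have "group_weight t h j \<le> (\<Sum>i=1..t. \<mu> * of_bool (grp m i = j))"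
    unfolding group_weight_def using assms by (intro sum_mono mult_right_mono) auto
  also have "\<dots> = real (card {i \<in> {1..t}. grp m i = j}) * \<mu>"
    by (simp add: Int_def flip: sum_distrib_left)
  also have "\<dots> \<le> real m * \<mu>"
    using card_group_le[OF m_pos] assms(2) by (intro mult_right_mono) auto
  finally show ?thesis .
qed

lemma group_weight_attach:
  assumes "t \<ge> 1" "recursive_tree t h" "a \<in> {1..t}"
  shows "group_weight (Suc t) (h(Suc t := a)) j
    = group_weight t h j + of_bool (grp m a = j) + (1 + \<beta>) * of_bool (grp m (Suc t) = j)"
proof -
  let ?h = "h(Suc t := a)"
  have "group_weight (Suc t) ?h j
      = (\<Sum>i=1..t. w (Suc t) ?h i * of_bool (grp m i = j)) + w (Suc t) ?h (Suc t) * of_bool (grp m (Suc t) = j)"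
    by (simp add: group_weight_def del: sum_mult_of_bool_eq)
  also have "w (Suc t) ?h (Suc t) = 1 + \<beta>"
    using assms by (intro vertex_weight_new) auto
  also have "(\<Sum>i=1..t. w (Suc t) ?h i * of_bool (grp m i = j))
      = (\<Sum>i=1..t. w t h i * of_bool (grp m i = j) + (if i = a then of_bool (grp m a = j) else 0))"
    using assms(1) by (intro sum.cong refl, subst vertex_weight_attach) auto
  also have "\<dots> = group_weight t h j + of_bool (grp m a = j)"
    using assms(3) by (simp add: sum.distrib group_weight_def del: sum_mult_of_bool_eq)
  finally show ?thesis .
qed

text \<open>Exchange of summation; \<open>t \<le> n * m\<close> puts every vertex present into one
  of the groups \<open>1..n\<close>.\<close>

lemma sum_group_weight_mult:
  assumes "t \<le> n * m"
  shows "(\<Sum>j=1..n. group_weight t h j * F j) = (\<Sum>i=1..t. w t h i * F (grp m i))"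
proof -
  have "(\<Sum>j=1..n. group_weight t h j * F j)
      = (\<Sum>i=1..t. \<Sum>j=1..n. w t h i * of_bool (grp m i = j) * F j)"
    unfolding group_weight_def sum_distrib_right by (rule sum.swap)
  also have "\<dots> = (\<Sum>i=1..t. w t h i * F (grp m i))"
  proof (intro sum.cong refl)
    fix i assume "i \<in> {1..t}"
    hence "grp m i \<in> {1..n}" using assms by (intro grp_bounds) auto
    moreover have "(\<Sum>j=1..n. w t h i * of_bool (grp m i = j) * F j)
        = (\<Sum>j=1..n. if grp m i = j then w t h i * F j else 0)"
      by (intro sum.cong) auto
    ultimately show "(\<Sum>j=1..n. w t h i * of_bool (grp m i = j) * F j) = w t h i * F (grp m i)"
      by simp
  qed
  finally show ?thesis .
qed

text \<open>Divided by \<open>L t\<close>, this is the mean weight of the group that the target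
  hits, which is why the drift of \<open>Q\<close> contains a multiple of \<open>Q\<close>
  itself.\<close>

lemma sum_vertex_weight_group_weight:
  assumes "t \<le> n * m"
  shows "(\<Sum>i=1..t. w t h i * group_weight t h (grp m i)) = Q t h"
  using sum_group_weight_mult[OF assms, of h "group_weight t h"] by (simp add: Q_def power2_eq_square)

text \<open>Two group weights change: by \<open>1\<close> at the target and by
  \<open>1 + \<beta>\<close> at the new vertex. The last summand is the cross term when both lie in
  one group.\<close>

lemma Q_attach:
  assumes "t \<ge> 1" "Suc t \<le> n * m" "recursive_tree t h" "a \<in> {1..t}"
  shows "Q (Suc t) (h(Suc t := a)) = Q t h + 1 + (1 + \<beta>)\<^sup>2 + 2 * group_weight t h (grp m a)
    + 2 * (1 + \<beta>) * Y t h + 2 * (1 + \<beta>) * of_bool (grp m a = grp m (Suc t))"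
proof -
  have "a \<in> {1..n * m}" "Suc t \<in> {1..n * m}" using assms by auto
  note b = this[THEN grp_bounds]
  have "Q (Suc t) (h(Suc t := a)) = (\<Sum>j=1..n. (group_weight t h j)\<^sup>2
      + (if grp m a = j then 1 + 2 * group_weight t h j else 0)
      + (if grp m (Suc t) = j then (1 + \<beta>)\<^sup>2 + 2 * (1 + \<beta>) * group_weight t h j
            + 2 * (1 + \<beta>) * of_bool (grp m a = j) else 0))"
    unfolding Q_def group_weight_attach[OF assms(1,3,4)]
    by (intro sum.cong refl) (auto simp: power2_eq_square algebra_simps)
  also have "\<dots> = Q t h + (1 + 2 * group_weight t h (grp m a))
      + ((1 + \<beta>)\<^sup>2 + 2 * (1 + \<beta>) * Y t h + 2 * (1 + \<beta>) * of_bool (grp m a = grp m (Suc t)))"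
    using b by (simp only: sum.distrib sum.delta' finite_atLeastAtMost if_True Q_def Y_def)
  finally show ?thesis by simp
qed

text \<open>If the vertex with index \<open>t + 2\<close> opens a new group, monotonicity of
  \<open>grp\<close> shows that no vertex present lies in it.\<close>

lemma Y_attach:
  assumes "t \<ge> 1" "recursive_tree t h" "a \<in> {1..t}"
  shows "Y (Suc t) (h(Suc t := a)) = same_group t * (Y t h + of_bool (grp m a = grp m (Suc t)) + (1 + \<beta>))"
proof (cases "grp m (Suc (Suc t)) = grp m (Suc t)")
  case True
  thus ?thesis
    using group_weight_attach[OF assms] by (simp add: Y_def same_group_def)
next
  case False
  hence "grp m (Suc t) < grp m (Suc (Suc t))"
    using grp_mono[of "Suc t" "Suc (Suc t)" m] by simp
  hence "grp m i \<noteq> grp m (Suc (Suc t))" if "i \<le> Suc t" for i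
    using grp_mono[OF that, of m] by simp
  hence "group_weight (Suc t) (h(Suc t := a)) (grp m (Suc (Suc t))) = 0"
    unfolding group_weight_def by (intro sum.neutral) auto
  thus ?thesis using False by (simp add: Y_def same_group_def)
qed

lemma attach_mean_indicator:
  "attach_mean \<beta> t (\<lambda>h'. of_bool (grp m (h' (Suc t)) = grp m (Suc t))) h = Y t h / L t"
  by (simp add: attach_mean_def Y_def group_weight_def del: sum_mult_of_bool_eq)

lemma attach_mean_Q:
  assumes "t \<ge> 1" "Suc t \<le> n * m" "recursive_tree t h"
  shows "attach_mean \<beta> t (Q (Suc t)) h
    = (1 + 2 / L t) * Q t h + 2 * (1 + \<beta>) * (1 + 1 / L t) * Y t h + (1 + (1 + \<beta>)\<^sup>2)"
proof -
  have "attach_mean \<beta> t (Q (Suc t)) h = attach_mean \<beta> t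
     (\<lambda>h'. (Q t h + 1 + (1 + \<beta>)\<^sup>2 + 2 * (1 + \<beta>) * Y t h) + (2 * group_weight t h (grp m (h' (Suc t)))
        + 2 * (1 + \<beta>) * of_bool (grp m (h' (Suc t)) = grp m (Suc t)))) h"
    using Q_attach[OF assms] by (intro attach_mean_cong) simp
  also have "\<dots> = (Q t h + 1 + (1 + \<beta>)\<^sup>2 + 2 * (1 + \<beta>) * Y t h)
      + (2 * (Q t h / L t) + 2 * (1 + \<beta>) * (Y t h / L t))"
    unfolding attach_mean_add attach_mean_cmult attach_mean_const[OF assms(1,3)] attach_mean_indicator
    using sum_vertex_weight_group_weight[of t h] assms(2) by (simp add: attach_mean_def)
  finally show ?thesis by (simp add: algebra_simps add_divide_distrib)
qed

lemma attach_mean_Y: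
  assumes "t \<ge> 1" "recursive_tree t h"
  shows "attach_mean \<beta> t (Y (Suc t)) h = same_group t * ((1 + 1 / L t) * Y t h + (1 + \<beta>))"
proof -
  have "attach_mean \<beta> t (Y (Suc t)) h = attach_mean \<beta> t
     (\<lambda>h'. same_group t * ((Y t h + (1 + \<beta>)) + of_bool (grp m (h' (Suc t)) = grp m (Suc t)))) h"
    using Y_attach[OF assms] by (intro attach_mean_cong) (simp add: algebra_simps)
  also have "\<dots> = same_group t * ((Y t h + (1 + \<beta>)) + Y t h / L t)"
    unfolding attach_mean_add attach_mean_cmult attach_mean_const[OF assms] attach_mean_indicator ..
  finally show ?thesis by (simp add: algebra_simps add_divide_distrib)
qed

text \<open>Conditional expectations of the final \<open>Q\<close> are affine in \<open>Q\<^sub>t\<close> and \<open>Y\<^sub>t\<close>;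
  \<open>coeff_Q\<close> and \<open>coeff_Y\<close> are the coefficients, obtained by running the two recursions
  above backwards from time \<open>n * m\<close>.\<close>

definition coeff_Q :: "nat \<Rightarrow> real" where
  "coeff_Q t = (\<Prod>s=t..<n * m. 1 + 2 / L s)"

primrec coeff_Y_rev :: "nat \<Rightarrow> real" where
  "coeff_Y_rev 0 = 0"
| "coeff_Y_rev (Suc k) = (1 + 1 / L (n * m - Suc k)) *
     (2 * (1 + \<beta>) * coeff_Q (n * m - k) + same_group (n * m - Suc k) * coeff_Y_rev k)"

definition coeff_Y :: "nat \<Rightarrow> real" where
  "coeff_Y t = coeff_Y_rev (n * m - t)"

lemma coeff_end [simp]: "coeff_Q (n * m) = 1" "coeff_Y (n * m) = 0"
  by (simp_all add: coeff_Q_def coeff_Y_def)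

lemma coeff_Q_rec: "t < n * m \<Longrightarrow> coeff_Q t = (1 + 2 / L t) * coeff_Q (Suc t)"
  by (simp add: coeff_Q_def prod.atLeast_Suc_lessThan)

lemma coeff_Y_rec:
  assumes "t < n * m"
  shows "coeff_Y t = (1 + 1 / L t) * (2 * (1 + \<beta>) * coeff_Q (Suc t) + same_group t * coeff_Y (Suc t))"
proof -
  have "n * m - t = Suc (n * m - Suc t)" "n * m - Suc (n * m - Suc t) = t" "n * m - (n * m - Suc t) = Suc t"
    using assms by auto
  thus ?thesis by (simp add: coeff_Y_def)
qed

lemma coeff_Q_pos: "t \<ge> 1 \<Longrightarrow> 0 < coeff_Q t"
  unfolding coeff_Q_def by (intro prod_pos) (auto intro!: add_pos_pos total_weight_pos)

text \<open>Each factor \<open>1 + 2 * \<alpha> / u s\<close> is at most a power of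
  \<open>u s / (u s - 1)\<close>, and these quotients telescope. The product starts at
  \<open>Suc t\<close>, hence at an index of at least \<open>2\<close>, where
  \<open>u s > 1\<close>.\<close>

lemma coeff_Q_le:
  assumes "1 \<le> t" "t < n * m"
  shows "coeff_Q (Suc t) \<le> (real (n * m) / u t) powr (2 * \<alpha>)"
proof -
  have u1: "u s > 1" if "s \<ge> 2" for s
    using that alpha_bounds by (simp add: u_def)
  have tele: "(\<Prod>s=a..<b. u s / (u s - 1)) = (u b - 1) / (u a - 1)" if "a \<le> b" "a \<ge> 2" for a b
    using that
  proof (induction b rule: dec_induct)
    case base thus ?case using u1[of a] by simp
  next
    case (step b)
    thus ?case using u1[of b] by (simp add: u_Suc)
  qed
  have "coeff_Q (Suc t) \<le> (\<Prod>s=Suc t..<n * m. (u s / (u s - 1)) powr (2 * \<alpha>))"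
    unfolding coeff_Q_def
  proof (intro prod_mono conjI)
    fix s assume s: "s \<in> {Suc t..<n * m}"
    have "2 / L s = 2 * \<alpha> / u s" by (simp add: total_weight_eq)
    thus "1 + 2 / L s \<le> (u s / (u s - 1)) powr (2 * \<alpha>)"
      using one_plus_divide_le_powr[of "u s" "2 * \<alpha>"] u1[of s] s assms alpha_bounds by auto
    show "0 \<le> 1 + 2 / L s"
      using s total_weight_pos[of s] by (auto intro!: add_nonneg_nonneg)
  qed
  also have "\<dots> = (\<Prod>s=Suc t..<n * m. u s / (u s - 1)) powr (2 * \<alpha>)"
    by (simp add: prod_powr_distrib)
  also have "\<dots> = ((u (n * m) - 1) / u t) powr (2 * \<alpha>)"
    using assms by (subst tele) (auto simp: u_Suc)
  also have "\<dots> \<le> (real (n * m) / u t) powr (2 * \<alpha>)"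
  proof (intro powr_mono2 divide_right_mono divide_nonneg_nonneg)
    show "0 \<le> u (n * m) - 1" using assms u1[of "n * m"] by simp
  qed (use alpha_bounds u_pos[OF assms(1)] in \<open>auto simp: u_def\<close>)
  finally show ?thesis .
qed

text \<open>One backward step, with \<open>L t\<close> replaced by its lower bound
  \<open>\<beta>\<close>, multiplies a bound of at least \<open>1\<close> on the ratio of
  \<open>coeff_Y\<close> to \<open>coeff_Q\<close> by at most this factor.\<close>

definition K\<^sub>Y :: real where
  "K\<^sub>Y = (1 + 1 / \<beta>) * (2 * (1 + \<beta>) + 1)"

lemma K_Y_ge_1: "1 \<le> K\<^sub>Y"
proof -
  have "1 * 1 \<le> (1 + 1 / \<beta>) * (2 * (1 + \<beta>) + 1)"
    using beta_pos by (intro mult_mono) auto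
  thus ?thesis by (simp add: K\<^sub>Y_def)
qed

text \<open>Within a group the exponent \<open>m - t mod m\<close> in the bound on
  \<open>coeff_Y\<close> drops by exactly one per step.\<close>

lemma same_group_mod:
  assumes "same_group t \<noteq> 0"
  shows "Suc t mod m = Suc (t mod m)"
proof -
  have "Suc t div m = t div m"
    using assms by (auto simp: same_group_def grp_def split: if_splits)
  thus ?thesis by (simp add: div_Suc mod_Suc split: if_splits)
qed

text \<open>Since \<open>Y\<close> is reset at each group boundary, the recursion for \<open>coeff_Y\<close> compounds over
  at most \<open>m\<close> consecutive steps.\<close>

lemma coeff_Y_bounds:
  assumes "1 \<le> t" "t \<le> n * m"
  shows "0 \<le> coeff_Y t \<and> coeff_Y t \<le> K\<^sub>Y ^ (m - t mod m) * coeff_Q t"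
  using assms(2,1)
proof (induction t rule: inc_induct)
  case base
  thus ?case using K_Y_ge_1 by simp
next
  case (step t)
  have t: "t \<ge> 1" "t < n * m" using step by auto
  have L: "\<beta> \<le> L t" "0 < L t" using total_weight_ge total_weight_pos t by auto
  have IH: "0 \<le> coeff_Y (Suc t)" "coeff_Y (Suc t) \<le> K\<^sub>Y ^ (m - Suc t mod m) * coeff_Q (Suc t)"
    using step by auto
  have Q: "0 < coeff_Q (Suc t)" by (rule coeff_Q_pos) simp
  have mod: "t mod m < m" using m_pos by simp
  have "coeff_Y t = (1 + 1 / L t) * (2 * (1 + \<beta>) * coeff_Q (Suc t) + same_group t * coeff_Y (Suc t))"
    using t by (intro coeff_Y_rec)
  also have "\<dots> \<le> (1 + 1 / \<beta>) * (2 * (1 + \<beta>) * coeff_Q (Suc t) + K\<^sub>Y ^ (m - Suc (t mod m)) * coeff_Q (Suc t))"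
  proof (rule mult_mono [OF _ add_left_mono])
    show "1 + 1 / L t \<le> 1 + 1 / \<beta>" using L beta_pos by (simp add: frac_le)
    show "same_group t * coeff_Y (Suc t) \<le> K\<^sub>Y ^ (m - Suc (t mod m)) * coeff_Q (Suc t)"
    proof (cases "same_group t = 0")
      case True
      thus ?thesis using K_Y_ge_1 Q by simp
    next
      case False
      with IH same_group_mod[OF False] show ?thesis by (auto simp: same_group_def)
    qed
  qed (use beta_pos Q IH in \<open>auto simp: same_group_def\<close>)
  \<comment> \<open>The power is at least \<open>1\<close>, so it may multiply the first summand
    too; factoring it out leaves one further factor \<open>K\<^sub>Y\<close>.\<close>
  also have "\<dots> \<le> (1 + 1 / \<beta>) * (2 * (1 + \<beta>) * (K\<^sub>Y ^ (m - Suc (t mod m)) * coeff_Q (Suc t))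
      + K\<^sub>Y ^ (m - Suc (t mod m)) * coeff_Q (Suc t))"
    using beta_pos Q one_le_power[OF K_Y_ge_1, of "m - Suc (t mod m)"]
    by (intro mult_left_mono add_mono order_refl) auto
  also have "\<dots> = K\<^sub>Y ^ Suc (m - Suc (t mod m)) * coeff_Q (Suc t)"
    by (simp add: K\<^sub>Y_def algebra_simps)
  also have "Suc (m - Suc (t mod m)) = m - t mod m"
    using mod by simp
  also have "K\<^sub>Y ^ (m - t mod m) * coeff_Q (Suc t) \<le> K\<^sub>Y ^ (m - t mod m) * coeff_Q t"
    unfolding coeff_Q_rec[OF t(2)] using K_Y_ge_1 Q L by (intro mult_left_mono) auto
  finally have "coeff_Y t \<le> K\<^sub>Y ^ (m - t mod m) * coeff_Q t" .
  moreover have "0 \<le> coeff_Y t"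
    unfolding coeff_Y_rec[OF t(2)] using IH Q L beta_pos
    by (auto simp: same_group_def intro!: mult_nonneg_nonneg add_nonneg_nonneg)
  ultimately show ?case by blast
qed

lemma coeff_Y_le:
  assumes "1 \<le> t" "t \<le> n * m"
  shows "coeff_Y t \<le> K\<^sub>Y ^ m * coeff_Q t"
proof -
  have "coeff_Y t \<le> K\<^sub>Y ^ (m - t mod m) * coeff_Q t"
    using coeff_Y_bounds[OF assms] by simp
  also have "\<dots> \<le> K\<^sub>Y ^ m * coeff_Q t"
    using coeff_Q_pos[OF assms(1)] K_Y_ge_1 by (intro mult_right_mono power_increasing) auto
  finally show ?thesis .
qed

section \<open>The martingale and its increments\<close>

text \<open>Centring \<open>Q\<close> and \<open>Y\<close> separately removes the constant terms of
  their drifts. The tree at time \<open>1\<close> is deterministic, so the process starts at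
  \<open>0\<close>; at time \<open>n * m\<close> the coefficients are \<open>1\<close> and
  \<open>0\<close>.\<close>

definition M :: "nat \<Rightarrow> (nat \<Rightarrow> nat) \<Rightarrow> real" where
  "M t h = coeff_Q t * (Q t h - E t (Q t)) + coeff_Y t * (Y t h - E t (Y t))"

lemma expectation_Q_Suc:
  assumes "t \<ge> 1" "Suc t \<le> n * m"
  shows "E (Suc t) (Q (Suc t))
    = (1 + 2 / L t) * E t (Q t) + 2 * (1 + \<beta>) * (1 + 1 / L t) * E t (Y t) + (1 + (1 + \<beta>)\<^sup>2)"
proof -
  have "E (Suc t) (Q (Suc t))
      = E t (\<lambda>h. (1 + 2 / L t) * Q t h + 2 * (1 + \<beta>) * (1 + 1 / L t) * Y t h + (1 + (1 + \<beta>)\<^sup>2))"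
    unfolding expectation_Suc[OF assms(1)] by (intro expectation_cong attach_mean_Q assms)
  also have "\<dots> = (1 + 2 / L t) * E t (Q t) + 2 * (1 + \<beta>) * (1 + 1 / L t) * E t (Y t) + (1 + (1 + \<beta>)\<^sup>2)"
    by (subst Bochner_Integration.integral_add[OF integrable_tree integrable_tree])+ simp
  finally show ?thesis .
qed

lemma expectation_Y_Suc:
  assumes "t \<ge> 1"
  shows "E (Suc t) (Y (Suc t)) = same_group t * ((1 + 1 / L t) * E t (Y t) + (1 + \<beta>))"
proof -
  have "E (Suc t) (Y (Suc t)) = E t (\<lambda>h. same_group t * ((1 + 1 / L t) * Y t h + (1 + \<beta>)))"
    unfolding expectation_Suc[OF assms] by (intro expectation_cong attach_mean_Y assms)
  also have "\<dots> = same_group t * E t (\<lambda>h. (1 + 1 / L t) * Y t h + (1 + \<beta>))"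
    by (rule integral_mult_right_zero)
  also have "E t (\<lambda>h. (1 + 1 / L t) * Y t h + (1 + \<beta>)) = (1 + 1 / L t) * E t (Y t) + (1 + \<beta>)"
    by (subst Bochner_Integration.integral_add[OF integrable_tree integrable_tree]) simp
  finally show ?thesis .
qed

lemma attach_mean_M_expand:
  assumes "t \<ge> 1" "recursive_tree t h"
  shows "attach_mean \<beta> t (M (Suc t)) h
    = coeff_Q (Suc t) * (attach_mean \<beta> t (Q (Suc t)) h - E (Suc t) (Q (Suc t)))
      + coeff_Y (Suc t) * (attach_mean \<beta> t (Y (Suc t)) h - E (Suc t) (Y (Suc t)))"
  unfolding M_def attach_mean_add attach_mean_cmult attach_mean_diff attach_mean_const[OF assms] ..

text \<open>The constant drifts cancel against the means, and the remaining factors are those of the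
  backward recursions for \<open>coeff_Q\<close> and \<open>coeff_Y\<close>.\<close>

lemma attach_mean_M:
  assumes "t \<ge> 1" "Suc t \<le> n * m" "recursive_tree t h"
  shows "attach_mean \<beta> t (M (Suc t)) h = M t h"
proof -
  have t: "t < n * m" using assms by simp
  show ?thesis
    unfolding attach_mean_M_expand[OF assms(1,3)] attach_mean_Q[OF assms] attach_mean_Y[OF assms(1,3)]
      expectation_Q_Suc[OF assms(1,2)] expectation_Y_Suc[OF assms(1)] M_def coeff_Q_rec[OF t] coeff_Y_rec[OF t]
    by (simp add: algebra_simps add_divide_distrib diff_divide_distrib)
qed

text \<open>\<open>2 * real m\<close> comes from the group of the target; the fraction collects
  terms bounded by constants, which \<open>\<beta> \<le> \<mu>\<close> turns into multiples of
  \<open>\<mu>\<close>.\<close>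

definition K :: real where
  "K = 2 * real m + (2 * (1 + \<beta>) + K\<^sub>Y ^ m) / \<beta>"

text \<open>Everything known at time \<open>t\<close> cancels, leaving the centred weight
  \<open>x\<close> of the group hit and the centred indicator \<open>y\<close> of hitting the group
  of the new vertex.\<close>

lemma M_increment_bound:
  assumes "t \<ge> 1" "Suc t \<le> n * m" "recursive_tree t h" "a \<in> {1..t}"
    and \<mu>: "\<And>i. i \<in> {1..t} \<Longrightarrow> w t h i \<le> \<mu>"
  shows "\<bar>M (Suc t) (h(Suc t := a)) - M t h\<bar> \<le> K * coeff_Q (Suc t) * \<mu>"
proof -
  let ?A = "coeff_Q (Suc t)" and ?B = "coeff_Y (Suc t)"
  define x where "x = group_weight t h (grp m a) - Q t h / L t"
  define y where "y = of_bool (grp m a = grp m (Suc t)) - Y t h / L t"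
  have L: "0 < L t" using total_weight_pos assms by simp
  have A: "0 < ?A" by (rule coeff_Q_pos) simp
  have B: "0 \<le> ?B" "?B \<le> K\<^sub>Y ^ m * ?A"
    using coeff_Y_bounds[of "Suc t"] coeff_Y_le[of "Suc t"] assms(2) by auto
  have \<mu>_ge: "\<beta> \<le> \<mu>" using \<mu>[OF assms(4)] vertex_weight_ge[of t h a] by linarith
  hence \<mu>_nonneg: "0 \<le> \<mu>" using beta_pos by simp
  \<comment> \<open>\<open>Q t h / L t\<close> is a weighted mean of group weights, so it lies in
    the same interval from \<open>0\<close> to \<open>real m * \<mu>\<close> as each of
    them.\<close>
  have "Q t h = (\<Sum>i=1..t. w t h i * group_weight t h (grp m i))"
    using assms(2) by (intro sum_vertex_weight_group_weight[symmetric]) simp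
  also have "\<dots> \<le> (\<Sum>i=1..t. w t h i * (real m * \<mu>))"
    by (intro sum_mono mult_left_mono group_weight_le \<mu> \<mu>_nonneg) (auto simp: less_imp_le vertex_weight_pos)
  also have "\<dots> = L t * (real m * \<mu>)"
    using sum_vertex_weight[OF assms(1,3)] by (simp flip: sum_distrib_right)
  finally have "Q t h / L t \<le> real m * \<mu>"
    using L by (simp add: divide_le_eq mult.commute)
  moreover have "0 \<le> Q t h / L t" using L by (simp add: Q_def sum_nonneg)
  moreover have "0 \<le> group_weight t h (grp m a)" "group_weight t h (grp m a) \<le> real m * \<mu>"
    using group_weight_le[OF \<mu> \<mu>_nonneg] by (auto simp: group_weight_nonneg)
  ultimately have x: "\<bar>x\<bar> \<le> real m * \<mu>" unfolding x_def by linarith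
  have "Y t h \<le> (\<Sum>i=1..t. w t h i)"
    unfolding Y_def group_weight_def using vertex_weight_pos by (intro sum_mono) (auto simp: less_imp_le)
  also have "\<dots> = L t" by (rule sum_vertex_weight[OF assms(1,3)])
  finally have "Y t h / L t \<le> 1" using L by simp
  moreover have "0 \<le> Y t h / L t" using L by (simp add: Y_def group_weight_nonneg)
  ultimately have y: "\<bar>y\<bar> \<le> 1" unfolding y_def by auto
  have "M (Suc t) (h(Suc t := a)) - M t h
      = ?A * (Q (Suc t) (h(Suc t := a)) - attach_mean \<beta> t (Q (Suc t)) h)
        + ?B * (Y (Suc t) (h(Suc t := a)) - attach_mean \<beta> t (Y (Suc t)) h)"
    unfolding attach_mean_M[OF assms(1-3), symmetric] attach_mean_M_expand[OF assms(1,3)]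
    unfolding M_def by (simp add: algebra_simps)
  also have "Q (Suc t) (h(Suc t := a)) - attach_mean \<beta> t (Q (Suc t)) h = 2 * x + 2 * (1 + \<beta>) * y"
    unfolding Q_attach[OF assms(1-4)] attach_mean_Q[OF assms(1-3)] x_def y_def
    by (simp add: algebra_simps add_divide_distrib)
  also have "Y (Suc t) (h(Suc t := a)) - attach_mean \<beta> t (Y (Suc t)) h = same_group t * y"
    unfolding Y_attach[OF assms(1,3,4)] attach_mean_Y[OF assms(1,3)] y_def by (simp add: algebra_simps)
  finally have "\<bar>M (Suc t) (h(Suc t := a)) - M t h\<bar> = \<bar>?A * (2 * x + 2 * (1 + \<beta>) * y) + ?B * (same_group t * y)\<bar>"
    by (rule arg_cong)
  also have "\<dots> \<le> \<bar>?A * (2 * x + 2 * (1 + \<beta>) * y)\<bar> + \<bar>?B * (same_group t * y)\<bar>"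
    by (rule abs_triangle_ineq)
  also have "\<dots> = ?A * \<bar>2 * x + 2 * (1 + \<beta>) * y\<bar> + ?B * (same_group t * \<bar>y\<bar>)"
    using A B by (simp add: abs_mult same_group_def)
  also have "\<dots> \<le> ?A * (2 * (real m * \<mu>) + 2 * (1 + \<beta>)) + (K\<^sub>Y ^ m * ?A) * (1 * 1)"
  proof (intro add_mono mult_mono)
    have "\<bar>2 * x + 2 * (1 + \<beta>) * y\<bar> \<le> 2 * \<bar>x\<bar> + 2 * (1 + \<beta>) * \<bar>y\<bar>"
      using abs_triangle_ineq[of "2 * x" "2 * (1 + \<beta>) * y"] beta_pos by (simp add: abs_mult)
    also have "\<dots> \<le> 2 * (real m * \<mu>) + 2 * (1 + \<beta>) * 1"
      using x y beta_pos by (intro add_mono mult_left_mono) auto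
    finally show "\<bar>2 * x + 2 * (1 + \<beta>) * y\<bar> \<le> 2 * (real m * \<mu>) + 2 * (1 + \<beta>)" by simp
  qed (use A B y K_Y_ge_1 in \<open>auto simp: same_group_def\<close>)
  also have "\<dots> = ?A * (2 * real m * \<mu> + (2 * (1 + \<beta>) + K\<^sub>Y ^ m) * 1)"
    by (simp add: algebra_simps)
  also have "\<dots> \<le> ?A * (2 * real m * \<mu> + (2 * (1 + \<beta>) + K\<^sub>Y ^ m) * (\<mu> / \<beta>))"
    using A beta_pos \<mu>_ge K_Y_ge_1 by (intro mult_left_mono add_left_mono) auto
  also have "\<dots> = K * ?A * \<mu>"
    by (simp add: K_def divide_inverse algebra_simps)
  finally show ?thesis .
qed

lemma K_pos: "0 < K"
  using beta_pos K_Y_ge_1 m_pos by (auto simp: K_def intro!: add_pos_nonneg divide_nonneg_nonneg add_nonneg_nonneg)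

end

section \<open>Concentration\<close>

context merged_tree
begin

text \<open>Independent of \<open>n\<close>: \<open>C\<close> bounds the moment \<open>E t (weight_moment (2 * k) t)\<close> and
  \<open>K\<close> the martingale increments; the last factor compares \<open>u (t + 1)\<close> with \<open>u t\<close>.\<close>

definition growth :: "nat \<Rightarrow> real \<Rightarrow> real" where
  "growth k C = 2 * 4 ^ k * (K * root (2 * k) C)\<^sup>2 / (1 - 2 * \<alpha>)
     * (1 + 1 / (1 - 2 * \<alpha>)) powr (2 * \<alpha>)"

lemma growth_pos:
  assumes "C > 0" "k \<ge> 1"
  shows "growth k C > 0"
proof -
  have "1 + 1 / (1 - 2 * \<alpha>) > 0" using alpha_bounds by (intro add_pos_pos) auto
  thus ?thesis
    using assms alpha_bounds K_pos by (auto simp: growth_def intro!: mult_pos_pos divide_pos_pos)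
qed

section \<open>Even moments of the martingale\<close>

text \<open>A discrete integral of \<open>u powr (- 2 * \<alpha>)\<close>. Concavity gives the slope
  at \<open>u (Suc t)\<close>; passing to \<open>u t\<close> costs a power of the maximal ratio of
  the two, which \<open>1 - 2 * \<alpha> \<le> u t\<close> controls.\<close>

lemma u_powr_step:
  assumes "t \<ge> 1"
  shows "(1 - 2 * \<alpha>) * u t powr (- 2 * \<alpha>)
    \<le> (1 + 1 / (1 - 2 * \<alpha>)) powr (2 * \<alpha>) * (u (Suc t) powr (1 - 2 * \<alpha>) - u t powr (1 - 2 * \<alpha>))"
proof -
  define \<rho> where "\<rho> = 1 + 1 / (1 - 2 * \<alpha>)"
  have \<rho>: "\<rho> > 0" using alpha_bounds unfolding \<rho>_def by (intro add_pos_pos) auto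
  have u: "u t > 0" "1 - 2 * \<alpha> \<le> u t" using u_pos[OF assms] u_ge[OF assms] by auto
  have "1 \<le> u t / (1 - 2 * \<alpha>)" using u alpha_bounds by simp
  hence le: "u (Suc t) \<le> \<rho> * u t" by (simp add: u_Suc \<rho>_def algebra_simps)
  have "u t powr (- 2 * \<alpha>) = \<rho> powr (2 * \<alpha>) * (\<rho> * u t) powr (- 2 * \<alpha>)"
    using \<rho> u by (simp add: powr_mult powr_minus field_simps)
  also have "\<dots> \<le> \<rho> powr (2 * \<alpha>) * u (Suc t) powr (- 2 * \<alpha>)"
    using le u \<rho> alpha_bounds by (intro mult_left_mono powr_mono2') (auto simp: u_Suc)
  finally have "(1 - 2 * \<alpha>) * u t powr (- 2 * \<alpha>)
      \<le> \<rho> powr (2 * \<alpha>) * ((1 - 2 * \<alpha>) * u (Suc t) powr (- 2 * \<alpha>))"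
    using alpha_bounds by (simp add: mult.left_commute)
  also have "\<dots> \<le> \<rho> powr (2 * \<alpha>) * (u (Suc t) powr (1 - 2 * \<alpha>) - u t powr (1 - 2 * \<alpha>))"
    using powr_diff_ge[of "u t" "1 - 2 * \<alpha>"] u alpha_bounds by (intro mult_left_mono) (auto simp: u_Suc)
  finally show ?thesis by (simp add: \<rho>_def)
qed

text \<open>The root stands in for the maximal weight: it bounds every weight, and the mean of its
  \<open>2 * k\<close>-th power is known.\<close>

lemma vertex_weight_le_root_moment:
  assumes "i \<in> {1..t}" "k \<ge> 1"
  shows "w t h i \<le> root (2 * k) (weight_moment (2 * k) t h)"
proof -
  have "w t h i ^ (2 * k) \<le> pochhammer (w t h i) (2 * k)"
    using vertex_weight_pos by (intro power_le_pochhammer) (simp add: less_imp_le)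
  also have "\<dots> \<le> weight_moment (2 * k) t h"
    unfolding weight_moment_def using assms(1) vertex_weight_pos
    by (intro member_le_sum) (auto simp: less_imp_le intro!: pochhammer_nonneg)
  finally have "root (2 * k) (w t h i ^ (2 * k)) \<le> root (2 * k) (weight_moment (2 * k) t h)"
    using assms(2) by (intro real_root_le_mono) auto
  thus ?thesis using vertex_weight_pos[of t h i] assms(2) by (simp add: real_root_power_cancel)
qed

lemma weight_moment_nonneg: "0 \<le> weight_moment q t h"
  unfolding weight_moment_def by (intro sum_nonneg pochhammer_nonneg vertex_weight_pos)

text \<open>The first-order term of \<open>power_add_le_even\<close> vanishes on average by the
  martingale property. The bound \<open>R\<close> need only be uniform over targets, so it may
  depend on \<open>h\<close>.\<close>

lemma attach_mean_M_power:
  assumes "t \<ge> 1" "Suc t \<le> n * m" "recursive_tree t h" "k \<ge> 1"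
    and R: "\<And>a. a \<in> {1..t} \<Longrightarrow> \<bar>M (Suc t) (h(Suc t := a)) - M t h\<bar> \<le> R"
  shows "attach_mean \<beta> t (\<lambda>h'. M (Suc t) h' ^ (2 * k)) h
    \<le> M t h ^ (2 * k) + 4 ^ k * (M t h ^ (2 * k - 2) * R\<^sup>2 + R ^ (2 * k))"
proof -
  let ?c = "M t h ^ (2 * k) + 4 ^ k * (M t h ^ (2 * k - 2) * R\<^sup>2 + R ^ (2 * k))"
  have "attach_mean \<beta> t (\<lambda>h'. M (Suc t) h' ^ (2 * k)) h
      \<le> attach_mean \<beta> t (\<lambda>h'. ?c + real (2 * k) * M t h ^ (2 * k - 1) * (M (Suc t) h' - M t h)) h"
  proof (rule attach_mean_mono [OF assms(1)])
    fix a assume a: "a \<in> {1..t}"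
    let ?y = "M (Suc t) (h(Suc t := a)) - M t h"
    have y: "?y ^ (2 * l) \<le> R ^ (2 * l)" for l
      using power_mono[OF R[OF a], of "2 * l"] by (simp add: power_even_abs)
    have "M (Suc t) (h(Suc t := a)) ^ (2 * k) = (M t h + ?y) ^ (2 * k)" by simp
    also have "\<dots> \<le> M t h ^ (2 * k) + real (2 * k) * M t h ^ (2 * k - 1) * ?y
           + 4 ^ k * (M t h ^ (2 * k - 2) * ?y\<^sup>2 + ?y ^ (2 * k))"
      by (rule power_add_le_even [OF assms(4)])
    also have "\<dots> \<le> M t h ^ (2 * k) + real (2 * k) * M t h ^ (2 * k - 1) * ?y
           + 4 ^ k * (M t h ^ (2 * k - 2) * R\<^sup>2 + R ^ (2 * k))"
      using y[of 1] y[of k] by (intro add_left_mono mult_left_mono add_mono) (auto simp: zero_le_even_power)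
    finally show "M (Suc t) (h(Suc t := a)) ^ (2 * k) \<le> ?c + real (2 * k) * M t h ^ (2 * k - 1) * ?y"
      by linarith
  qed
  also have "\<dots> = ?c"
    unfolding attach_mean_add attach_mean_cmult attach_mean_diff attach_mean_const[OF assms(1,3)]
      attach_mean_M[OF assms(1-3)] by simp
  finally show ?thesis .
qed

text \<open>Induction over time: \<open>even_moment_increment\<close> enlarges the base of the
  \<open>k\<close>-th power by a multiple of \<open>c\<^sup>2\<close>, and these enlargements
  telescope.\<close>

lemma expectation_M_power:
  assumes k: "2 \<le> k" and C: "C > 0"
    and moment: "\<And>t. t \<ge> 1 \<Longrightarrow> E t (weight_moment (2 * k) t) \<le> C * u t powr (real (2 * k) * \<alpha>)"
    and t: "1 \<le> t" "t \<le> n * m"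
  shows "E t (\<lambda>h. M t h ^ (2 * k))
    \<le> (growth k C * real (n * m) powr (4 * \<alpha>) * u t powr (1 - 2 * \<alpha>)) ^ k"
  using t
proof (induction t rule: dec_induct)
  case base
  have "E 1 (\<lambda>h. M 1 h ^ (2 * k)) = 0"
    using k by (simp add: expectation_1 M_def)
  also have "\<dots> \<le> (growth k C * real (n * m) powr (4 * \<alpha>) * u 1 powr (1 - 2 * \<alpha>)) ^ k"
    using growth_pos[OF C, of k] k by simp
  finally show ?case .
next
  case (step t)
  define N where "N = real (n * m)"
  have t: "t \<ge> 1" "Suc t \<le> n * m" "t < n * m" using step by auto
  have N: "N > 0" using t unfolding N_def of_nat_0_less_iff by linarith
  have u: "u t > 0" by (rule u_pos [OF t(1)])
  define V where "V = growth k C * N powr (4 * \<alpha>) * u t powr (1 - 2 * \<alpha>)"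
  have V: "V > 0" using growth_pos[OF C, of k] k N u by (simp add: V_def)
  define \<mu> where "\<mu> h = root (2 * k) (weight_moment (2 * k) t h)" for h
  define R where "R h = K * coeff_Q (Suc t) * \<mu> h" for h
  \<comment> \<open>Bounds the \<open>2 * k\<close>-norm of \<open>R\<close>: the bound on
    \<open>coeff_Q\<close> times the norm of the substitute for the maximal weight.\<close>
  define c where "c = K * (N / u t) powr (2 * \<alpha>) * (root (2 * k) C * u t powr \<alpha>)"
  have A: "0 < coeff_Q (Suc t)" by (rule coeff_Q_pos) simp
  have C': "root (2 * k) C > 0" using C k by simp
  have c: "c > 0" using K_pos N u C' by (simp add: c_def)
  have R_power: "R h ^ (2 * k) = (K * coeff_Q (Suc t)) ^ (2 * k) * weight_moment (2 * k) t h" for h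
    using k weight_moment_nonneg[of "2 * k" t h] by (simp add: R_def \<mu>_def power_mult_distrib)
  have "E t (\<lambda>h. R h ^ (2 * k)) = (K * coeff_Q (Suc t)) ^ (2 * k) * E t (weight_moment (2 * k) t)"
    unfolding R_power by (rule integral_mult_right_zero)
  also have "\<dots> \<le> (K * (N / u t) powr (2 * \<alpha>)) ^ (2 * k) * (C * u t powr (real (2 * k) * \<alpha>))"
  proof (rule mult_mono [OF power_mono moment[OF t(1)]])
    show "K * coeff_Q (Suc t) \<le> K * (N / u t) powr (2 * \<alpha>)"
      using K_pos coeff_Q_le[OF t(1,3)] by (intro mult_left_mono) (auto simp: N_def)
    show "0 \<le> E t (weight_moment (2 * k) t)"
      by (intro Bochner_Integration.integral_nonneg weight_moment_nonneg)
  qed (use K_pos A in auto)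
  also have "C * u t powr (real (2 * k) * \<alpha>) = (root (2 * k) C * u t powr \<alpha>) ^ (2 * k)"
    using C k u by (simp add: power_mult_distrib powr_power mult.commute)
  also have "(K * (N / u t) powr (2 * \<alpha>)) ^ (2 * k) * \<dots> = c ^ (2 * k)"
    unfolding c_def by (rule power_mult_distrib [symmetric])
  finally have ER: "E t (\<lambda>h. R h ^ (2 * k)) \<le> c ^ (2 * k)" .
  have "E (Suc t) (\<lambda>h. M (Suc t) h ^ (2 * k)) = E t (attach_mean \<beta> t (\<lambda>h'. M (Suc t) h' ^ (2 * k)))"
    by (rule expectation_Suc [OF t(1)])
  also have "\<dots> \<le> E t (\<lambda>h. M t h ^ (2 * k) + 4 ^ k * (M t h ^ (2 * k - 2) * (R h)\<^sup>2 + R h ^ (2 * k)))"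
  proof (intro expectation_mono attach_mean_M_power t(1,2))
    fix h a assume h: "recursive_tree t h" and a: "a \<in> {1..t}"
    show "\<bar>M (Suc t) (h(Suc t := a)) - M t h\<bar> \<le> R h"
      unfolding R_def \<mu>_def using k
      by (intro M_increment_bound t(1,2) h a vertex_weight_le_root_moment) auto
  qed (use k in auto)
  also have "\<dots> \<le> (V + 2 * 4 ^ k * c\<^sup>2) ^ k"
    using step t ER by (intro even_moment_increment finite_set_tree_pmf k V c) (auto simp: V_def N_def)
  also have "\<dots> \<le> (growth k C * N powr (4 * \<alpha>) * u (Suc t) powr (1 - 2 * \<alpha>)) ^ k"
  proof (rule power_mono)
    \<comment> \<open>The exponents \<open>- 4 * \<alpha>\<close> from the coefficient and
      \<open>2 * \<alpha>\<close> from the weights leave the term that \<open>u_powr_step\<close>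
      telescopes.\<close>
    have "c\<^sup>2 = (K * root (2 * k) C)\<^sup>2 * N powr (4 * \<alpha>) * u t powr (- 2 * \<alpha>)"
    proof -
      have *: "((N / u t) powr (2 * \<alpha>))\<^sup>2 = N powr (4 * \<alpha>) * u t powr (- 4 * \<alpha>)"
        using N u by (simp add: powr_power powr_divide powr_minus field_simps)
      have **: "(u t powr \<alpha>)\<^sup>2 = u t powr (2 * \<alpha>)"
        using u by (simp add: powr_power mult.commute)
      have "c\<^sup>2 = (K * root (2 * k) C)\<^sup>2 * N powr (4 * \<alpha>) * (u t powr (- 4 * \<alpha>) * u t powr (2 * \<alpha>))"
        unfolding c_def power_mult_distrib * ** by (simp only: mult_ac)
      also have "u t powr (- 4 * \<alpha>) * u t powr (2 * \<alpha>) = u t powr (- 2 * \<alpha>)"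
        by (simp flip: powr_add)
      finally show ?thesis .
    qed
    hence "2 * 4 ^ k * c\<^sup>2 = 2 * 4 ^ k * (K * root (2 * k) C)\<^sup>2 / (1 - 2 * \<alpha>) * N powr (4 * \<alpha>)
        * ((1 - 2 * \<alpha>) * u t powr (- 2 * \<alpha>))"
      using alpha_bounds by (simp add: field_simps)
    also have "\<dots> \<le> 2 * 4 ^ k * (K * root (2 * k) C)\<^sup>2 / (1 - 2 * \<alpha>) * N powr (4 * \<alpha>)
        * ((1 + 1 / (1 - 2 * \<alpha>)) powr (2 * \<alpha>) * (u (Suc t) powr (1 - 2 * \<alpha>) - u t powr (1 - 2 * \<alpha>)))"
      using alpha_bounds by (intro mult_left_mono u_powr_step t(1)) auto
    also have "\<dots> = growth k C * N powr (4 * \<alpha>) * (u (Suc t) powr (1 - 2 * \<alpha>) - u t powr (1 - 2 * \<alpha>))"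
      by (simp only: growth_def mult_ac)
    finally show "V + 2 * 4 ^ k * c\<^sup>2 \<le> growth k C * N powr (4 * \<alpha>) * u (Suc t) powr (1 - 2 * \<alpha>)"
      by (simp add: V_def right_diff_distrib)
    show "0 \<le> V + 2 * 4 ^ k * c\<^sup>2" using V by simp
  qed
  finally show ?case by (simp add: N_def)
qed

section \<open>From group weights to pairs of adjacent half-edges\<close>

lemma group_weight_end:
  assumes "n \<ge> 1" "recursive_tree (n * m) h" "j \<in> {1..n}"
  shows "group_weight (n * m) h j = \<beta> * real m + real (deg_m m n h j)"
proof -
  have N: "n * m \<ge> 1" using assms(1) m_pos by (simp add: Suc_le_eq One_nat_def)
  have "card {i \<in> {1..n * m}. grp m i = j} = m"
    using group_members[OF m_pos, of j n] assms(3) by simp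
  thus ?thesis
    unfolding group_weight_def sum_vertex_weight_mult[OF N assms(2)]
    by (simp add: deg_m_def Int_def)
qed

text \<open>A degree is the group weight minus \<open>b = \<beta> * real m\<close>, so
  \<open>d choose 2\<close> is quadratic in the weight. The linear terms sum to a multiple of the
  deterministic total weight, leaving \<open>Q\<close> as the only random part.\<close>

lemma D_pairs_eq:
  assumes "n \<ge> 1" "recursive_tree (n * m) h"
  shows "D_pairs m n h = Q (n * m) h / 2
    + (real n * ((\<beta> * real m)\<^sup>2 + \<beta> * real m) - (2 * \<beta> * real m + 1) * L (n * m)) / 2"
proof -
  have N: "n * m \<ge> 1" using assms(1) m_pos by (simp add: Suc_le_eq One_nat_def)
  define b where "b = \<beta> * real m"
  define g where "g = group_weight (n * m) h"
  have "(\<Sum>j=1..n. g j) = L (n * m)"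
    using sum_group_weight_mult[of "n * m" h "\<lambda>_. 1"] sum_vertex_weight[OF N assms(2)] by (simp add: g_def)
  moreover have "D_pairs m n h = (\<Sum>j=1..n. (g j)\<^sup>2 / 2 + (b\<^sup>2 + b) / 2 - (2 * b + 1) / 2 * g j)"
    unfolding D_pairs_def real_choose_two
  proof (intro sum.cong refl)
    fix j assume "j \<in> {1..n}"
    hence d: "real (deg_m m n h j) = g j - b"
      using group_weight_end[OF assms] by (simp add: g_def b_def)
    show "((real (deg_m m n h j))\<^sup>2 - real (deg_m m n h j)) / 2
        = (g j)\<^sup>2 / 2 + (b\<^sup>2 + b) / 2 - (2 * b + 1) / 2 * g j"
      unfolding d by (simp add: power2_eq_square field_simps)
  qed
  moreover have "\<dots> = (\<Sum>j=1..n. (g j)\<^sup>2) / 2 + real n * ((b\<^sup>2 + b) / 2) - (2 * b + 1) / 2 * (\<Sum>j=1..n. g j)"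
    by (simp add: sum.distrib sum_subtractf sum_distrib_left sum_divide_distrib)
  ultimately show ?thesis
    by (simp add: Q_def g_def b_def field_simps)
qed

lemma D_pairs_centered:
  assumes "n \<ge> 1" "recursive_tree (n * m) h"
  shows "D_pairs m n h - E (n * m) (D_pairs m n) = M (n * m) h / 2"
proof -
  define d where "d = (real n * ((\<beta> * real m)\<^sup>2 + \<beta> * real m) - (2 * \<beta> * real m + 1) * L (n * m)) / 2"
  have "E (n * m) (D_pairs m n) = E (n * m) (\<lambda>h. Q (n * m) h / 2 + d)"
    unfolding d_def by (intro expectation_cong D_pairs_eq assms(1))
  also have "\<dots> = E (n * m) (Q (n * m)) / 2 + d"
    by (subst Bochner_Integration.integral_add[OF integrable_tree integrable_tree]) simp
  finally show ?thesis
    unfolding D_pairs_eq[OF assms] by (simp add: M_def d_def)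
qed

text \<open>At the final time \<open>u (n * m) \<le> n * m\<close>, and the exponents
  \<open>4 * \<alpha>\<close> and \<open>1 - 2 * \<alpha>\<close> add up.\<close>

lemma expectation_D_pairs_power:
  assumes "2 \<le> k" "C > 0" "n \<ge> 1"
    and "\<And>t. t \<ge> 1 \<Longrightarrow> E t (weight_moment (2 * k) t) \<le> C * u t powr (real (2 * k) * \<alpha>)"
  shows "E (n * m) (\<lambda>h. (D_pairs m n h - E (n * m) (D_pairs m n)) ^ (2 * k))
    \<le> (growth k C * real (n * m) powr (1 + 2 * \<alpha>)) ^ k"
proof -
  let ?N = "n * m"
  have N: "?N \<ge> 1" using assms(3) m_pos by (simp add: Suc_le_eq One_nat_def)
  have "E ?N (\<lambda>h. (D_pairs m n h - E ?N (D_pairs m n)) ^ (2 * k)) \<le> E ?N (\<lambda>h. M ?N h ^ (2 * k))"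
  proof (rule expectation_mono)
    fix h assume h: "recursive_tree ?N h"
    have "(D_pairs m n h - E ?N (D_pairs m n)) ^ (2 * k) = M ?N h ^ (2 * k) / 2 ^ (2 * k)"
      unfolding D_pairs_centered[OF assms(3) h] by (rule power_divide)
    also have "\<dots> \<le> M ?N h ^ (2 * k) / 1"
      by (intro divide_left_mono one_le_power) (auto simp: zero_le_even_power)
    finally show "(D_pairs m n h - E ?N (D_pairs m n)) ^ (2 * k) \<le> M ?N h ^ (2 * k)" by simp
  qed
  also have "\<dots> \<le> (growth k C * real ?N powr (4 * \<alpha>) * u ?N powr (1 - 2 * \<alpha>)) ^ k"
    using assms N by (intro expectation_M_power) auto
  also have "\<dots> \<le> (growth k C * (real ?N powr (4 * \<alpha>) * real ?N powr (1 - 2 * \<alpha>))) ^ k"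
    unfolding mult.assoc using growth_pos[OF assms(2), of k] assms(1) alpha_bounds u_pos[OF N]
    by (intro power_mono mult_left_mono powr_mono2) (auto simp: u_def)
  also have "real ?N powr (4 * \<alpha>) * real ?N powr (1 - 2 * \<alpha>) = real ?N powr (1 + 2 * \<alpha>)"
    by (simp add: add.commute flip: powr_add)
  finally show ?thesis .
qed

end

text \<open>Markov's inequality for the \<open>2 * k\<close>-th power: the threshold exceeds the
  scale of the moment bound by \<open>n powr \<epsilon>\<close>, which gains
  \<open>n powr (- 2 * k * \<epsilon>)\<close>.\<close>

lemma (in positive_beta) D_pairs_concentration:
  assumes "m \<ge> 1" "\<epsilon> > 0" "\<gamma> > 0"
  shows "\<exists>n0::nat. \<forall>n\<ge>n0. measure_pmf.prob (\<T> (n * m))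
     {h. \<bar>D_pairs m n h - E (n * m) (D_pairs m n)\<bar> \<ge> real n powr (1 / 2 + \<alpha> + \<epsilon>)}
     \<le> real n powr (- \<gamma>)"
proof -
  \<comment> \<open>\<open>1 / \<alpha> < k\<close> makes the weight moment bound applicable;
    \<open>\<gamma> / \<epsilon> < k\<close> leaves a negative power of \<open>n\<close> to absorb
    the constant.\<close>
  obtain k :: nat where "max (max (1 / \<alpha>) (\<gamma> / \<epsilon>)) 2 < real k"
    using reals_Archimedean2 by blast
  hence k: "1 / \<alpha> < real k" "\<gamma> / \<epsilon> < real k" "2 \<le> k" by auto
  hence k_alpha: "real k * \<alpha> > 1" and k_eps: "\<gamma> < real k * \<epsilon>"
    using alpha_bounds assms by (auto simp: field_simps)
  hence "real (2 * k) * \<alpha> > 1" by simp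
  then obtain C where C: "C > 0"
    "\<And>t. t \<ge> 1 \<Longrightarrow> E t (weight_moment (2 * k) t) \<le> C * u t powr (real (2 * k) * \<alpha>)"
    using expectation_weight_moment_bound by blast
  \<comment> \<open>Independent of \<open>n\<close>: \<open>C\<close> was obtained before
    \<open>n\<close> is fixed, and \<open>growth\<close> depends only on \<open>\<beta>\<close>,
    \<open>m\<close>, \<open>k\<close> and \<open>C\<close>.\<close>
  define B where "B = (merged_tree.growth \<beta> m k C * real m powr (1 + 2 * \<alpha>)) ^ k"
  have "((\<lambda>n. real n powr (\<gamma> - 2 * real k * \<epsilon>)) \<longlongrightarrow> 0) sequentially"
  proof (rule tendsto_neg_powr)
    have "0 < real k * \<epsilon>" using k_eps assms by linarith
    thus "\<gamma> - 2 * real k * \<epsilon> < 0" using k_eps by linarith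
  qed (rule filterlim_real_sequentially)
  hence "((\<lambda>n. B * real n powr (\<gamma> - 2 * real k * \<epsilon>)) \<longlongrightarrow> B * 0) sequentially"
    by (intro tendsto_intros)
  hence "\<forall>\<^sub>F n in sequentially. B * real n powr (\<gamma> - 2 * real k * \<epsilon>) < 1"
    by (intro order_tendstoD(2)) auto
  then obtain n1 where n1: "\<And>n. n \<ge> n1 \<Longrightarrow> B * real n powr (\<gamma> - 2 * real k * \<epsilon>) < 1"
    by (auto simp: eventually_sequentially)
  show ?thesis
  proof (intro exI[of _ "max 1 n1"] allI impI)
    fix n :: nat assume "n \<ge> max 1 n1"
    hence n: "n \<ge> 1" "n \<ge> n1" by auto
    interpret merged_tree \<beta> m n by unfold_locales (rule assms(1))
    define Z where "Z h = D_pairs m n h - E (n * m) (D_pairs m n)" for h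
    define x where "x = real n powr (1 / 2 + \<alpha> + \<epsilon>)"
    have x: "x > 0" using n by (simp add: x_def)
    have "E (n * m) (\<lambda>h. Z h ^ (2 * k)) \<le> (growth k C * real (n * m) powr (1 + 2 * \<alpha>)) ^ k"
      unfolding Z_def by (intro expectation_D_pairs_power k C n)
    also have "\<dots> = B * real n powr (real k * (1 + 2 * \<alpha>))"
      using n by (simp add: B_def powr_mult power_mult_distrib powr_power mult_ac)
    finally have EZ: "E (n * m) (\<lambda>h. Z h ^ (2 * k)) \<le> B * real n powr (real k * (1 + 2 * \<alpha>))" .
    have "measure_pmf.prob (\<T> (n * m)) {h. \<bar>Z h\<bar> \<ge> x}
        \<le> measure_pmf.prob (\<T> (n * m)) {h \<in> space (measure_pmf (\<T> (n * m))). Z h ^ (2 * k) \<ge> x ^ (2 * k)}"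
    proof (intro measure_pmf.finite_measure_mono subsetI CollectI conjI)
      fix h assume "h \<in> {h. \<bar>Z h\<bar> \<ge> x}"
      hence "x ^ (2 * k) \<le> \<bar>Z h\<bar> ^ (2 * k)" using x by (intro power_mono) auto
      thus "x ^ (2 * k) \<le> Z h ^ (2 * k)" by (simp add: power_even_abs)
    qed auto
    also have "\<dots> \<le> E (n * m) (\<lambda>h. Z h ^ (2 * k)) / x ^ (2 * k)"
      using x by (intro integral_Markov_inequality_measure[where A = "{}"] integrable_tree)
        (auto simp: zero_le_even_power)
    also have "\<dots> \<le> B * real n powr (real k * (1 + 2 * \<alpha>)) / x ^ (2 * k)"
      using EZ x by (intro divide_right_mono) auto
    also have "\<dots> = B * real n powr (- 2 * real k * \<epsilon>)"
    proof -
      have "x ^ (2 * k) = real n powr (real k * (1 + 2 * \<alpha>)) * real n powr (2 * real k * \<epsilon>)"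
        using n unfolding x_def powr_add [symmetric] by (simp add: powr_power algebra_simps)
      thus ?thesis using n by (simp add: powr_minus divide_inverse)
    qed
    also have "\<dots> = B * real n powr (\<gamma> - 2 * real k * \<epsilon>) * real n powr (- \<gamma>)"
      by (simp add: mult.assoc flip: powr_add)
    also have "\<dots> \<le> 1 * real n powr (- \<gamma>)"
      using n1[OF n(2)] by (intro mult_right_mono) auto
    finally show "measure_pmf.prob (\<T> (n * m))
        {h. \<bar>D_pairs m n h - E (n * m) (D_pairs m n)\<bar> \<ge> real n powr (1 / 2 + \<alpha> + \<epsilon>)}
        \<le> real n powr (- \<gamma>)"
      by (simp add: Z_def x_def)
  qed
qed

theorem theorem9:
  fixes \<beta> :: real and m :: nat
  assumes "\<beta> > 0" and "m \<ge> 1"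
  shows "\<forall>\<epsilon>>0. \<forall>\<gamma>>0. \<exists>n0::nat. \<forall>n\<ge>n0.
           measure_pmf.prob (tree_pmf \<beta> (n * m))
             {h. \<bar>D_pairs m n h - measure_pmf.expectation (tree_pmf \<beta> (n * m)) (D_pairs m n)\<bar>
                 \<ge> real n powr ((4 + \<beta>) / (4 + 2 * \<beta>) + \<epsilon>)}
           \<le> real n powr (- \<gamma>)"
proof -
  interpret positive_beta \<beta> by unfold_locales (rule assms(1))
  have "(4 + \<beta>) / (4 + 2 * \<beta>) = 1 / 2 + \<alpha>"
    using assms(1) by (simp add: \<alpha>_def field_simps)
  thus ?thesis using D_pairs_concentration[OF assms(2)] by simp
qed

end
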